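(* Let $d\ge 1$ and let $\mu$ be a probability measure on $\mathbb{R}^d$ that has a density $f$ with respect to Lebesgue measure. Let $X_1,X_2,\ldots$ be i.i.d. random vectors with distribution $\mu$, and for each $n$ let $S_1$ be the Voronoi cell of $X_1$ in the Voronoi partition defined by $X_1,\ldots,X_n$. Then, as $n\to\infty$: (i) $n\,\mathbb{E}\left[\mu(S_1)\mid X_1=x\right]\to 1$ for $\mu$-almost all $x$; (ii) $n^2\,\mathbb{E}\left[\mu(S_1)^2\mid X_1=x\right]\to \alpha(d)$ for $\mu$-almost all $x$, where $\alpha(d)=\mathbb{E}\left[2/W^2\right]$ is the constant, depending only on $d$, defined in the context.
   Context: $\|\cdot\|$ is the Euclidean norm on $\mathbb{R}^d$, $\lambda$ is Lebesgue measure on $\mathbb{R}^d$, and $B_{x,r}$ is the closed ball of radius $r$ centered at $x$. Voronoi partition: given $X_1,\ldots,X_n$, the cell $S_i$ consists of all points of $\mathbb{R}^d$ whose nearest neighbor among $X_1,\ldots,X_n$ is $X_i$, ties being broken in favor of smaller indices. In particular $S_1=\{y\in\mathbb{R}^d:\|y-X_1\|\le\|y-X_j\| \text{ for all } j=2,\ldots,n\}$; it depends on $n$. Conditioning on $X_1=x$ means that $X_1$ is replaced by the fixed point $x$ while $X_2,\ldots,X_n$ remain i.i.d. with distribution $\mu$. Definition of $\alpha(d)$: let $Y$ be uniformly distributed in $B_{0,1}$, let $\overline{1}=(1,0,\ldots,0)\in\mathbb{R}^d$, and set $$W=\frac{\lambda\left(B_{\overline{1},1}\cup B_{Y,\|Y\|}\right)}{\lambda(B_{0,1})},\qquad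 \alpha(d)=\mathbb{E}\left[\frac{2}{W^2}\right].$$ *)

theory Defs
  imports "HOL-Probability.Probability"
begin

text \<open>
  The points are \<open>p 1, \<dots>, p n\<close>; ties are broken in favour of smaller indices.
\<close>

definition voronoi_cell :: "(nat \<Rightarrow> real ^ 'd) \<Rightarrow> nat \<Rightarrow> nat \<Rightarrow> (real ^ 'd) set" where
  "voronoi_cell p n i =
     {y. \<forall>j\<in>{1..n}. if j < i then norm (y - p i) < norm (y - p j)
                                else norm (y - p i) \<le> norm (y - p j)}"

text \<open>
  The vector \<open>(1, 0, \<dots>, 0)\<close>. A finite index type carries no order, so an arbitrary
  but fixed coordinate plays the role of the first one.
\<close>

definition one_vec :: "real ^ 'd" where
  "one_vec = axis (SOME k. True) 1"

definition ball_ratio :: "real ^ 'd \<Rightarrow> real" where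
  "ball_ratio y =
     measure lborel (cball one_vec 1 \<union> cball y (norm y)) / measure lborel (cball (0 :: real ^ 'd) 1)"

text \<open>
  The dimension \<open>d\<close> is \<open>CARD('d)\<close>, and the expectation is over \<open>Y\<close> uniform on the closed unit ball.
\<close>

definition alpha :: "'d::finite itself \<Rightarrow> real" where
  "alpha _ = (\<integral>y. 2 / (ball_ratio y)\<^sup>2 \<partial>uniform_measure lborel (cball (0 :: real ^ 'd) 1))"

end

theory Submission
  imports Defs
begin

text \<open>
  Given \<open>X\<^sub>1 = x\<close>, a point \<open>y\<close> lies in the cell of \<open>x\<close> iff no other sample point falls in the open
  ball \<open>B\<^sub>y\<close> around \<open>y\<close> through \<open>x\<close>. Hence the first two moments of the cell measure are the
  integrals of \<open>(1 - \<mu>(B\<^sub>y))\<^bsup>n - 1\<^esup>\<close> and \<open>(1 - \<mu>(B\<^sub>y \<union> B\<^sub>z))\<^bsup>n - 1\<^esup>\<close> against \<open>\<mu>\<close> and \<open>\<mu> \<Otimes> \<mu>\<close>.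
  At a Lebesgue point \<open>x\<close> with \<open>f x > 0\<close>, substitute \<open>y = x + h u\<close> where \<open>n h\<^bsup>d\<^esup> f(x) = 1\<close>: then
  \<open>n \<mu>(B\<^sub>y \<union> B\<^sub>z)\<close> tends to the volume of \<open>ball u \<bar>u\<bar> \<union> ball v \<bar>v\<bar>\<close>, the rescaled density tends to 1
  in a weighted \<open>L\<^sup>1\<close> space, and the points far from \<open>x\<close> contribute an exponentially small amount.
  The limits are the integrals of \<open>exp (- vol (ball u \<bar>u\<bar>))\<close>, which is 1, and of
  \<open>exp (- vol (ball u \<bar>u\<bar> \<union> ball v \<bar>v\<bar>))\<close>. In the latter, restrict to \<open>\<bar>v\<bar> \<le> \<bar>u\<bar>\<close> by symmetry, put
  \<open>v = \<bar>u\<bar> w\<close>, rotate \<open>u\<close> to the first axis and integrate out \<open>\<bar>u\<bar>\<close> to obtain the mean of \<open>2 / W\<^sup>2\<close>.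
\<close>

section \<open>Lebesgue points\<close>

text \<open>The density is only measurable: at a Lebesgue point \<open>f (x + h u)\<close> need not
  converge for a given \<open>u\<close>, so dominated convergence cannot act on the density. The
  density is first replaced by the constant \<open>f x\<close>, at a cost measured in weighted L1;
  dominated convergence then acts on the powers alone, which do converge pointwise. The relevant
  balls pass through \<open>x\<close> instead of being centred there, but each lies in a centred
  ball of twice the radius, so centred averages suffice. Both moments are instances of one limit
  theorem on a general Euclidean space. The second uses it on pairs, at \<open>(x, x)\<close>, where
  the dominating weight is a product and the deviation of the product density reduces to that of
  \<open>f\<close>. In the constant, 2 counts the orderings of the two norms, and the square of W
  comes from the integral of \<open>t * exp (- t * w)\<close> over the half-line, which is
  \<open>1 / w\<^sup>2\<close>; the factor \<open>t\<close> there is, up to the unit ball volume,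
  the Jacobian of the scaling by the larger norm.\<close>

lemma open_ball_measure_gt:
  fixes N :: "'a::euclidean_space measure"
  assumes "sets N = sets borel"
  shows "open {x. \<exists>r. 0 < r \<and> r < d \<and> emeasure N (ball x r) > c r}"
  unfolding open_dist
proof (clarify)
  fix x r assume r: "0 < r" "r < d" and gt: "c r < emeasure N (ball x r)"
  \<comment> \<open>Continuity from below: a slightly smaller concentric ball already exceeds the
    threshold, and it lies inside the ball of radius \<open>r\<close> about every nearby centre. The
    witness \<open>r\<close> is kept; only the centre moves.\<close>
  have Un: "ball x r = (\<Union>k. ball x (r - r / real (Suc k)))"
  proof (intro equalityI subsetI)
    fix y assume y: "y \<in> ball x r"
    obtain k where "r / (r - dist x y) < real k"
      using reals_Archimedean2 by blast
    then have "r / real (Suc k) < r - dist x y"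
      using y r by (simp add: field_simps)
    then show "y \<in> (\<Union>k. ball x (r - r / real (Suc k)))"
      by (auto intro!: exI[of _ k])
  next
    fix y assume "y \<in> (\<Union>k. ball x (r - r / real (Suc k)))"
    then obtain k where "dist x y < r - r / real (Suc k)" by auto
    also have "\<dots> \<le> r" using r by simp
    finally show "y \<in> ball x r" by simp
  qed
  have "(\<lambda>k. emeasure N (ball x (r - r / real (Suc k)))) \<longlonglongrightarrow> emeasure N (\<Union>k. ball x (r - r / real (Suc k)))"
  proof (rule Lim_emeasure_incseq)
    show "range (\<lambda>k. ball x (r - r / real (Suc k))) \<subseteq> sets N" unfolding assms by (simp add: image_subset_iff)
    show "incseq (\<lambda>k. ball x (r - r / real (Suc k)))"
    proof (intro incseq_SucI subset_ball)
      fix k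
      have "r / real (Suc (Suc k)) \<le> r / real (Suc k)" using r by (intro frac_le) auto
      then show "r - r / real (Suc k) \<le> r - r / real (Suc (Suc k))" by linarith
    qed
  qed
  from order_tendstoD(1)[OF this gt[unfolded Un]] obtain k
    where k: "c r < emeasure N (ball x (r - r / real (Suc k)))"
    by (auto simp: eventually_sequentially)
  show "\<exists>e>0. \<forall>y. dist y x < e \<longrightarrow> y \<in> {x. \<exists>r. 0 < r \<and> r < d \<and> emeasure N (ball x r) > c r}"
  proof (intro exI conjI allI impI)
    show "0 < r / real (Suc k)" using r by simp
    fix y assume "dist y x < r / real (Suc k)"
    then have "ball x (r - r / real (Suc k)) \<subseteq> ball y r"
      by (intro ball_subset_ball_iff[THEN iffD2]) (auto simp: dist_commute)
    then have "emeasure N (ball x (r - r / real (Suc k))) \<le> emeasure N (ball y r)"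
      using assms by (intro emeasure_mono) auto
    with k r show "y \<in> {x. \<exists>r. 0 < r \<and> r < d \<and> emeasure N (ball x r) > c r}"
      by (auto intro!: exI[of _ r])
  qed
qed

text \<open>Vitali differentiation. For a bounded piece A of \<open>E\<close>, outer regularity
  gives an open U around A with N(U) close to N(A), which is at most s * vol(A). Disjoint balls
  inside U, each of N-density above t, cover A up to a null set, so t * vol(A) is at most N(U). As s
  < t, the volume vanishes.\<close>

lemma null_set_of_density_gap:
  fixes g :: "'a::euclidean_space \<Rightarrow> real"
  assumes g: "integrable lborel g" "\<And>x. 0 \<le> g x" and s: "0 < s" "s < t"
  defines "N \<equiv> density lborel (\<lambda>x. ennreal (g x))"
  assumes E: "E \<in> sets borel" "\<And>x. x \<in> E \<Longrightarrow> g x < s"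
    and gt: "\<And>x d. x \<in> E \<Longrightarrow> 0 < d \<Longrightarrow>
      \<exists>r. 0 < r \<and> r < d \<and> emeasure N (ball x r) > ennreal t * emeasure lborel (ball x r)"
  shows "E \<in> null_sets lborel"
proof -
  have gm[measurable]: "g \<in> borel_measurable lborel" using g by auto
  have sN: "sets N = sets borel" by (simp add: N_def)
  have finN: "emeasure N (space N) \<noteq> \<infinity>"
    using g by (auto simp: N_def emeasure_density nn_integral_eq_integral)
  \<comment> \<open>Bounded pieces have finite volume, so that \<open>t * l \<le> s * l\<close>
    between real numbers forces \<open>l = 0\<close> at the end.\<close>
  have "emeasure lborel (E \<inter> ball 0 (real m)) = 0" for m
  proof -
    let ?A = "E \<inter> ball 0 (real m)"
    have A: "?A \<in> sets borel" using E by auto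
    have Afin: "emeasure lborel ?A < \<infinity>"
      by (rule le_less_trans[OF emeasure_mono[of _ "ball 0 (real m)"]]) (auto simp: emeasure_ball)
    have NA: "emeasure N ?A \<le> ennreal s * emeasure lborel ?A"
    proof -
      have "emeasure N ?A = (\<integral>\<^sup>+x. ennreal (g x) * indicator ?A x \<partial>lborel)"
        using A by (simp add: N_def emeasure_density)
      also have "\<dots> \<le> (\<integral>\<^sup>+x. ennreal s * indicator ?A x \<partial>lborel)"
        by (intro nn_integral_mono) (use E(2) less_imp_le in \<open>fastforce simp: indicator_def intro!: ennreal_leI\<close>)
      also have "\<dots> = ennreal s * emeasure lborel ?A"
        by (rule nn_integral_cmult_indicator) (use A in \<open>simp only: sets_lborel\<close>)
      finally show ?thesis .
    qed
    have le: "ennreal t * emeasure lborel ?A \<le> ennreal s * emeasure lborel ?A + ennreal e" if "e > 0" for e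
    proof -
      have NAf: "emeasure N ?A < \<infinity>"
        using NA Afin by (metis ennreal_mult_less_top ennreal_less_top le_less_trans infinity_ennreal_def)
      have "emeasure N ?A = (INF U\<in>{U. ?A \<subseteq> U \<and> open U}. emeasure N U)"
        by (rule outer_regular[OF sN finN A])
      moreover have "emeasure N ?A < emeasure N ?A + ennreal e"
        using NAf that ennreal_add_left_cancel_less[of "emeasure N ?A" 0 "ennreal e"]
        by (simp add: less_top)
      ultimately obtain U where U: "?A \<subseteq> U" "open U" "emeasure N U < emeasure N ?A + ennreal e"
        by (metis (no_types, lifting) INF_less_iff mem_Collect_eq)
      \<comment> \<open>Pairs (centre, radius). \<open>gt\<close> supplies arbitrarily small radii
        at each point, which is the fineness that Vitali's theorem asks for; staying inside
        \<open>U\<close> only bounds the radius further.\<close>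
      define K where "K = {i. fst i \<in> ?A \<and> 0 < snd i \<and> ball (fst i) (snd i) \<subseteq> U \<and>
         emeasure N (ball (fst i) (snd i)) > ennreal t * emeasure lborel (ball (fst i) (snd i))}"
      have cov: "\<exists>i. i \<in> K \<and> x \<in> ball (fst i) (snd i) \<and> snd i < d" if x: "x \<in> ?A" "0 < d" for x d
      proof -
        obtain e where e: "0 < e" "ball x e \<subseteq> U" using U x openE by blast
        obtain r where r: "0 < r" "r < min e d"
          "emeasure N (ball x r) > ennreal t * emeasure lborel (ball x r)"
          using gt[of x "min e d"] x e by auto
        then show ?thesis using r e x unfolding K_def
          by (intro exI[of _ "(x, r)"]) (auto dest: subset_ball)
      qed
      obtain C where C: "countable C" "C \<subseteq> K"
        "pairwise (\<lambda>i j. disjnt (ball (fst i) (snd i)) (ball (fst j) (snd j))) C"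
        "negligible (?A - (\<Union>i\<in>C. ball (fst i) (snd i)))"
        by (rule Vitali_covering_theorem_balls[where S="?A" and K=K and a=fst and r=snd]) (rule cov)
      let ?U = "\<Union>i\<in>C. ball (fst i) (snd i)"
      have Um: "?U \<in> sets borel" by (intro borel_open) auto
      have disj: "disjoint_family_on (\<lambda>i. ball (fst i) (snd i)) C"
        using C(3) by (auto simp: disjoint_family_on_def pairwise_def disjnt_def)
      have "?A - ?U \<in> null_sets lborel"
        using C(4) A Um by (simp add: negligible_iff_null_sets null_sets_completion_iff)
      then have "emeasure lborel ?A \<le> emeasure lborel ?U"
      proof -
        assume n: "?A - ?U \<in> null_sets lborel"
        have "emeasure lborel ?A \<le> emeasure lborel (?U \<union> (?A - ?U))"
          using A Um by (intro emeasure_mono) auto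
        also have "\<dots> = emeasure lborel ?U" using n Um by (intro emeasure_Un_null_set) auto
        finally show ?thesis .
      qed
      then have "ennreal t * emeasure lborel ?A \<le> ennreal t * emeasure lborel ?U"
        by (rule mult_left_mono) simp
      also have "emeasure lborel ?U = (\<integral>\<^sup>+i. emeasure lborel (ball (fst i) (snd i)) \<partial>count_space C)"
        using C(1) disj by (intro emeasure_UN_countable) auto
      also have "ennreal t * \<dots> = (\<integral>\<^sup>+i. ennreal t * emeasure lborel (ball (fst i) (snd i)) \<partial>count_space C)"
        by (simp add: nn_integral_cmult)
      also have "\<dots> \<le> (\<integral>\<^sup>+i. emeasure N (ball (fst i) (snd i)) \<partial>count_space C)"
        using C(2) by (intro nn_integral_mono) (auto simp: K_def intro: less_imp_le)
      also have "\<dots> = emeasure N ?U"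
        using C(1) disj sN by (intro emeasure_UN_countable[symmetric]) auto
      also have "\<dots> \<le> emeasure N U"
        using U C(2) sN by (intro emeasure_mono) (auto simp: K_def)
      also have "\<dots> \<le> ennreal s * emeasure lborel ?A + ennreal e"
        using U(3) NA by (meson add_right_mono less_imp_le order_trans)
      finally show ?thesis .
    qed
    define l where "l = measure lborel ?A"
    have l: "emeasure lborel ?A = ennreal l" "0 \<le> l"
      using Afin by (simp_all add: l_def emeasure_eq_ennreal_measure)
    have "t * l \<le> s * l + e" if "e > 0" for e
    proof -
      have "ennreal (t * l) \<le> ennreal (s * l + e)"
        using le[OF that] l s that by (simp add: ennreal_mult)
      then show ?thesis using l s that by (simp add: ennreal_le_iff del: ennreal_plus)
    qed
    then have "t * l \<le> s * l" by (rule field_le_epsilon)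
    then have "l = 0" using s l by (simp add: mult_le_cancel_right)
    then show ?thesis using l by simp
  qed
  then have "E \<inter> ball 0 (real m) \<in> null_sets lborel" for m using E by (intro null_setsI) auto
  then have "(\<Union>m. E \<inter> ball 0 (real m)) \<in> null_sets lborel" by (rule null_sets_UN)
  moreover have "(\<Union>m. E \<inter> ball 0 (real m)) = E"
    by (auto simp: dist_norm) (meson reals_Archimedean2)
  ultimately show ?thesis by simp
qed

text \<open>Supplies the measurability that \<open>null_set_of_density_gap\<close> assumes: taking
  the radii below 1 / (k + 1) for every k exhibits the set as \<open>{x. g x < s}\<close>
  intersected with countably many open sets.\<close>

lemma null_set_upper_density_gt:
  fixes g :: "'a::euclidean_space \<Rightarrow> real"
  assumes g: "integrable lborel g" "\<And>x. 0 \<le> g x" and s: "0 < s" "s < t"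
  defines "N \<equiv> density lborel (\<lambda>x. ennreal (g x))"
  shows "{x. g x < s \<and> (\<forall>k. \<exists>r. 0 < r \<and> r < 1 / real (Suc k) \<and>
    emeasure N (ball x r) > ennreal t * emeasure lborel (ball x r))} \<in> null_sets lborel" (is "?E \<in> _")
proof -
  have gm[measurable]: "g \<in> borel_measurable lborel" using g by auto
  have sN: "sets N = sets borel" by (simp add: N_def)
  have op: "open {x. \<exists>r. 0 < r \<and> r < d \<and> emeasure N (ball x r) > ennreal t * emeasure lborel (ball x r)}"
    for d
  proof -
    \<comment> \<open>By translation invariance the threshold depends on the radius only, the form
      treated by \<open>open_ball_measure_gt\<close>.\<close>
    have eq: "emeasure lborel (ball x r) = emeasure lborel (ball (0::'a) r)" for x :: 'a and r
      by (cases "r \<ge> 0") (simp_all add: emeasure_ball ball_empty)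
    show ?thesis
      using open_ball_measure_gt[OF sN, of d "\<lambda>r. ennreal t * emeasure lborel (ball (0::'a) r)"]
      by (subst eq)
  qed
  have E_eq: "?E = {x. g x < s} \<inter> (\<Inter>k. {x. \<exists>r. 0 < r \<and> r < 1 / real (Suc k) \<and> emeasure N (ball x r) > ennreal t * emeasure lborel (ball x r)})"
    by auto
  have E[measurable]: "?E \<in> sets borel"
    unfolding E_eq
  proof (intro sets.Int sets.countable_INT)
    show "{x. g x < s} \<in> sets borel" using gm by simp
  qed (use op in \<open>auto intro!: borel_open\<close>)
  show ?thesis
  proof (rule null_set_of_density_gap[OF g s E, folded N_def])
    fix x and d :: real assume x: "x \<in> ?E" and d: "0 < d"
    obtain k where k: "inverse (real (Suc k)) < d" using reals_Archimedean[of d] d by auto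
    obtain r where "0 < r" "r < 1 / real (Suc k)"
      "emeasure N (ball x r) > ennreal t * emeasure lborel (ball x r)" using x by blast
    then show "\<exists>r. 0 < r \<and> r < d \<and> emeasure N (ball x r) > ennreal t * emeasure lborel (ball x r)"
      using k by (intro exI[of _ r]) (auto simp: inverse_eq_divide)
  qed auto
qed

text \<open>For rational q near f x, the deviation from f x is at most the deviation from q plus a
  small error, and the density-gap lemma controls the ball averages of |f - q|. Rational q, s, t and
  integer cutoffs m give countably many null sets, so one exceptional set serves all of
  them.\<close>

theorem AE_lebesgue_point:
  fixes f :: "'a::euclidean_space \<Rightarrow> real"
  assumes f: "integrable lborel f"
  shows "AE x in lborel. \<forall>e>0. \<exists>d>0. \<forall>r. 0 < r \<longrightarrow> r < d \<longrightarrow>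
    (\<integral>\<^sup>+y\<in>ball x r. ennreal \<bar>f y - f x\<bar> \<partial>lborel) \<le> ennreal e * emeasure lborel (ball x r)"
proof -
  have fm[measurable]: "f \<in> borel_measurable borel" using f by auto
  \<comment> \<open>The cutoff makes \<open>\<bar>f - q\<bar>\<close> integrable although a non-zero
    constant is not integrable on the whole space.\<close>
  define g where "g q m y = \<bar>f y - q\<bar> * indicator (ball 0 (real m)) y" for q :: real and m :: nat and y :: 'a
  have gm[measurable]: "g q m \<in> borel_measurable borel" for q m unfolding g_def[abs_def]
    by (intro borel_measurable_times borel_measurable_indicator) auto
  have gi: "integrable lborel (g q m)" for q m
  proof -
    have "integrable lborel (\<lambda>y. \<bar>f y\<bar> + \<bar>q\<bar> * indicator (ball 0 (real m)) y)"
      using f by (intro Bochner_Integration.integrable_add integrable_mult_right integrable_abs)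
        (auto simp: emeasure_ball)
    then show ?thesis
      by (rule Bochner_Integration.integrable_bound) (auto simp: g_def indicator_def)
  qed
  have "AE x in lborel. \<forall>q\<in>\<rat>. \<forall>s\<in>\<rat>. \<forall>t\<in>\<rat>. \<forall>m. 0 < s \<longrightarrow> s < t \<longrightarrow>
    \<not> (g q m x < s \<and> (\<forall>k. \<exists>r. 0 < r \<and> r < 1 / real (Suc k) \<and>
       emeasure (density lborel (\<lambda>x. ennreal (g q m x))) (ball x r) > ennreal t * emeasure lborel (ball x r)))"
    (is "AE x in lborel. ?P x")
  proof (intro AE_ball_countable[THEN iffD2] ballI AE_all_countable[THEN iffD2] allI countable_rat)
    fix q s t :: real and m
    show "AE x in lborel. 0 < s \<longrightarrow> s < t \<longrightarrow>
    \<not> (g q m x < s \<and> (\<forall>k. \<exists>r. 0 < r \<and> r < 1 / real (Suc k) \<and>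
       emeasure (density lborel (\<lambda>x. ennreal (g q m x))) (ball x r) > ennreal t * emeasure lborel (ball x r)))"
    proof (cases "0 < s \<and> s < t")
      case True
      show ?thesis
        by (rule AE_I'[OF null_set_upper_density_gt[of "g q m" s t]])
          (use gi True in \<open>auto simp: g_def\<close>)
    qed auto
  qed
  then show ?thesis
  proof eventually_elim
    case (elim x)
    show ?case
    proof (intro allI impI)
      fix e :: real assume e: "e > 0"
      \<comment> \<open>The chain |f x - q| < e/4 < s < e/2 < t < 3e/4 leaves room for the error e/4
        of replacing f x by q, since t + e/4 < e.\<close>
      obtain q where q: "q \<in> \<rat>" "f x - e/4 < q" "q < f x + e/4"
        using Rats_dense_in_real[of "f x - e/4" "f x + e/4"] e by auto
      obtain s where s: "s \<in> \<rat>" "e/4 < s" "s < e/2"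
        using Rats_dense_in_real[of "e/4" "e/2"] e by auto
      obtain t where t: "t \<in> \<rat>" "e/2 < t" "t < 3*e/4"
        using Rats_dense_in_real[of "e/2" "3*e/4"] e by auto
      \<comment> \<open>Balls of radius below 1 about x then stay inside the cutoff.\<close>
      obtain m :: nat where m: "norm x + 1 < real m" using reals_Archimedean2 by blast
      have "g q m x < s" using q s by (auto simp: g_def indicator_def)
      moreover have "0 < s" "s < t" using s t e by auto
      ultimately obtain k where k: "\<And>r. 0 < r \<Longrightarrow> r < 1 / real (Suc k) \<Longrightarrow>
         emeasure (density lborel (\<lambda>x. ennreal (g q m x))) (ball x r) \<le> ennreal t * emeasure lborel (ball x r)"
        using elim[rule_format, OF q(1) s(1) t(1), of m] by (meson not_less)
      show "\<exists>d>0. \<forall>r. 0 < r \<longrightarrow> r < d \<longrightarrow>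
        (\<integral>\<^sup>+y\<in>ball x r. ennreal \<bar>f y - f x\<bar> \<partial>lborel) \<le> ennreal e * emeasure lborel (ball x r)"
      proof (intro exI[of _ "1 / real (Suc k)"] conjI allI impI)
        fix r :: real assume r: "0 < r" "r < 1 / real (Suc k)"
        have "1 / real (Suc k) \<le> 1" by simp
        then have r1: "r < 1" using r by linarith
        have sub: "y \<in> ball 0 (real m)" if "y \<in> ball x r" for y
          using that r1 m norm_triangle_sub[of y x] by (auto simp: dist_norm norm_minus_commute)
        have "(\<integral>\<^sup>+y\<in>ball x r. ennreal \<bar>f y - f x\<bar> \<partial>lborel) \<le>
          (\<integral>\<^sup>+y. ennreal (g q m y) * indicator (ball x r) y + ennreal (e/4) * indicator (ball x r) y \<partial>lborel)"
        proof (intro nn_integral_mono)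
          fix y
          have "\<bar>f y - f x\<bar> \<le> \<bar>f y - q\<bar> + e/4" using q by auto
          then have "ennreal \<bar>f y - f x\<bar> \<le> ennreal \<bar>f y - q\<bar> + ennreal (e/4)"
            using e by (subst ennreal_plus[symmetric]) (auto intro!: ennreal_leI simp del: ennreal_plus)
          then show "ennreal \<bar>f y - f x\<bar> * indicator (ball x r) y \<le>
             ennreal (g q m y) * indicator (ball x r) y + ennreal (e/4) * indicator (ball x r) y"
            using sub[of y] by (cases "y \<in> ball x r") (auto simp: g_def)
        qed
        also have "\<dots> = (\<integral>\<^sup>+y. ennreal (g q m y) * indicator (ball x r) y \<partial>lborel) +
            ennreal (e/4) * emeasure lborel (ball x r)"
          by (subst nn_integral_add)
            (auto simp: nn_integral_cmult_indicator intro!: borel_measurable_times_ennreal borel_measurable_indicator)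
        also have "(\<integral>\<^sup>+y. ennreal (g q m y) * indicator (ball x r) y \<partial>lborel) \<le>
           ennreal t * emeasure lborel (ball x r)"
          using k[OF r] by (simp add: emeasure_density)
        also have "ennreal t * emeasure lborel (ball x r) + ennreal (e/4) * emeasure lborel (ball x r)
          = ennreal (t + e/4) * emeasure lborel (ball x r)"
          using t e by (subst ennreal_plus) (auto simp: distrib_right)
        also have "\<dots> \<le> ennreal e * emeasure lborel (ball x r)"
          using t by (intro mult_right_mono ennreal_leI) auto
        finally show "(\<integral>\<^sup>+y\<in>ball x r. ennreal \<bar>f y - f x\<bar> \<partial>lborel) \<le> ennreal e * emeasure lborel (ball x r)"
          by (meson add_right_mono order_trans)
      qed simp
    qed
  qed
qed

section \<open>Integrals with exponential weights\<close>

lemma nn_integral_lborel_affine: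
  fixes x :: "'a::euclidean_space"
  assumes [measurable]: "F \<in> borel_measurable borel" and h: "0 < h"
  shows "(\<integral>\<^sup>+y. F y \<partial>lborel) = ennreal (h ^ DIM('a)) * (\<integral>\<^sup>+u. F (x + h *\<^sub>R u) \<partial>lborel)"
  using h by (subst lborel_affine[of h x])
    (auto simp: nn_integral_density nn_integral_distr nn_integral_cmult ennreal_power)

text \<open>Tail probability of the exponential law. With \<open>a = norm u\<close> it writes
  \<open>exp (- c * norm u)\<close> as a mixture of indicators of balls about the origin (layer
  cake); the strict inequality makes these balls open.\<close>

lemma nn_integral_exponential_tail:
  assumes c: "0 < c" and a: "0 \<le> a"
  shows "(\<integral>\<^sup>+\<rho>. ennreal (erlang_density 0 c \<rho>) * indicator {a<..} \<rho> \<partial>lborel) = ennreal (exp (- c * a))"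
proof -
  have "(\<integral>\<^sup>+\<rho>. ennreal (erlang_density 0 c \<rho>) * indicator {a<..} \<rho> \<partial>lborel)
     = (\<integral>\<^sup>+\<rho>. ennreal (c * exp (- c * \<rho>)) * indicator {a..} \<rho> \<partial>lborel)"
  proof (rule nn_integral_cong_AE)
    show "AE \<rho> in lborel. ennreal (erlang_density 0 c \<rho>) * indicator {a<..} \<rho> =
       ennreal (c * exp (- c * \<rho>)) * indicator {a..} \<rho>"
      using AE_lborel_singleton[of a]
      by eventually_elim (use a in \<open>auto simp: erlang_density_def indicator_def\<close>)
  qed
  also have "\<dots> = ennreal (0 - (- exp (- c * a)))"
  proof (rule nn_integral_FTC_atLeast)
    show "((\<lambda>\<rho>. - exp (- c * \<rho>)) \<longlongrightarrow> 0) at_top"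
      using c by real_asymp
  qed (use c in \<open>auto intro!: derivative_eq_intros\<close>)
  finally show ?thesis by simp
qed

lemma measurable_norm_less_pair[measurable]:
  "(\<lambda>p. indicator {norm (fst p :: 'a::euclidean_space)<..} (snd p :: real) :: ennreal) \<in> borel_measurable (borel \<Otimes>\<^sub>M borel)"
  "(\<lambda>p. indicator {norm (snd p :: 'a::euclidean_space)<..} (fst p :: real) :: ennreal) \<in> borel_measurable (borel \<Otimes>\<^sub>M borel)"
proof -
  have "(\<lambda>p. indicator {norm (fst p :: 'a)<..} (snd p) :: ennreal) = indicator {p. norm (fst p) < snd p}"
    "(\<lambda>p. indicator {norm (snd p :: 'a)<..} (fst p) :: ennreal) = indicator {p. norm (snd p) < fst p}"
    by (auto simp: indicator_def)
  then show
    "(\<lambda>p. indicator {norm (fst p :: 'a)<..} (snd p :: real) :: ennreal) \<in> borel_measurable (borel \<Otimes>\<^sub>M borel)"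
    "(\<lambda>p. indicator {norm (snd p :: 'a)<..} (fst p :: real) :: ennreal) \<in> borel_measurable (borel \<Otimes>\<^sub>M borel)"
    by simp_all
qed

lemma measurable_norm_less[measurable]:
  "(\<lambda>u. indicator {norm (u :: 'a::euclidean_space)<..} (r :: real) :: ennreal) \<in> borel_measurable borel"
proof -
  have "(\<lambda>u. indicator {norm (u :: 'a)<..} r :: ennreal) = indicator (ball 0 r)"
    by (auto simp: indicator_def)
  then show ?thesis by (simp add: borel_measurable_indicator)
qed

text \<open>By the layer cake formula the integral is a mean over \<rho>, under the exponential law,
  of ball integrals of g divided by h^d. \<open>small\<close> sends each of these to 0, while
  \<open>bound\<close>, valid at all radii, dominates them by C * \<rho>^d, whose mean is a moment
  of that law.\<close>

lemma tendsto_nn_integral_exp_weight: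
  fixes g :: "'a::euclidean_space \<Rightarrow> ennreal" and x :: 'a
  assumes g[measurable]: "g \<in> borel_measurable borel"
    and bound: "\<And>r. 0 < r \<Longrightarrow> (\<integral>\<^sup>+y\<in>ball x r. g y \<partial>lborel) \<le> ennreal (C * r ^ DIM('a))"
    and small: "\<And>e. 0 < e \<Longrightarrow> \<exists>d>0. \<forall>r. 0 < r \<longrightarrow> r < d \<longrightarrow>
      (\<integral>\<^sup>+y\<in>ball x r. g y \<partial>lborel) \<le> ennreal (e * r ^ DIM('a))"
    and h: "\<And>n. 0 < h n" "h \<longlonglongrightarrow> 0" and c: "0 < c" and C: "0 \<le> C"
  shows "(\<lambda>n. \<integral>\<^sup>+u. ennreal (exp (- c * norm u)) * g (x + h n *\<^sub>R u) \<partial>lborel) \<longlonglongrightarrow> 0"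
proof -
  define I where "I r = (\<integral>\<^sup>+y. g y * indicator (ball x r) y \<partial>lborel)" for r
  define E where "E \<rho> = ennreal (erlang_density 0 c \<rho>)" for \<rho>
  have [measurable]: "E \<in> borel_measurable borel"
    unfolding E_def[abs_def] by measurable
  define J where "J n \<rho> = (\<integral>\<^sup>+u. g (x + h n *\<^sub>R u) * indicator {norm u<..} \<rho> \<partial>lborel)" for n \<rho>
  \<comment> \<open>Substitution y = x + h u: J is the ball integral I at radius h * \<rho>, divided
    by h^d.\<close>
  have J_eq: "J n \<rho> * ennreal (h n ^ DIM('a)) = I (h n * \<rho>)" for n \<rho>
  proof -
    have "I (h n * \<rho>) = ennreal (h n ^ DIM('a)) * (\<integral>\<^sup>+u. g (x + h n *\<^sub>R u) * indicator (ball x (h n * \<rho>)) (x + h n *\<^sub>R u) \<partial>lborel)"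
      unfolding I_def
      by (rule nn_integral_lborel_affine) (use h(1) in \<open>auto intro!: borel_measurable_times_ennreal borel_measurable_indicator\<close>)
    also have "(\<integral>\<^sup>+u. g (x + h n *\<^sub>R u) * indicator (ball x (h n * \<rho>)) (x + h n *\<^sub>R u) \<partial>lborel) = J n \<rho>"
      unfolding J_def using h(1)[of n]
      by (intro nn_integral_cong) (auto simp: indicator_def dist_norm)
    finally show ?thesis by (simp add: mult.commute)
  qed
  have hpos: "0 < h n ^ DIM('a)" for n using h(1) by simp
  have J_le: "J n \<rho> \<le> ennreal (K * \<rho> ^ DIM('a))"
    if "I (h n * \<rho>) \<le> ennreal (K * (h n * \<rho>) ^ DIM('a))" "0 \<le> K" "0 < \<rho>" for n \<rho> K
  proof -
    have "J n \<rho> * ennreal (h n ^ DIM('a)) \<le> ennreal (K * \<rho> ^ DIM('a)) * ennreal (h n ^ DIM('a))"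
      unfolding J_eq using that h(1)[of n]
      by (subst ennreal_mult[symmetric]) (auto simp: power_mult_distrib mult_ac)
    then show ?thesis
      using hpos[of n]
      by (subst (asm) (1 2) mult.commute, subst (asm) ennreal_mult_le_mult_iff) (auto simp: ennreal_eq_0_iff not_le)
  qed
  have J0: "J n \<rho> = 0" if "\<rho> \<le> 0" for n \<rho>
  proof -
    have "indicator {norm u<..} \<rho> = (0::ennreal)" for u :: 'a
      using that norm_ge_zero[of u] unfolding indicator_def by (simp add: not_less order_trans[OF that])
    then show ?thesis by (simp add: J_def)
  qed
  have Jm[measurable]: "J n \<in> borel_measurable borel" for n
    unfolding J_def[abs_def] by measurable
  have *: "(\<integral>\<^sup>+u. ennreal (exp (- c * norm u)) * g (x + h n *\<^sub>R u) \<partial>lborel) = (\<integral>\<^sup>+\<rho>. E \<rho> * J n \<rho> \<partial>lborel)" for n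
  proof -
    have "(\<integral>\<^sup>+u. ennreal (exp (- c * norm u)) * g (x + h n *\<^sub>R u) \<partial>lborel) =
      (\<integral>\<^sup>+u. (\<integral>\<^sup>+\<rho>. E \<rho> * indicator {norm u<..} \<rho> * g (x + h n *\<^sub>R u) \<partial>lborel) \<partial>lborel)"
      by (subst nn_integral_multc) (auto simp: E_def nn_integral_exponential_tail[OF c])
    also have "\<dots> = (\<integral>\<^sup>+\<rho>. (\<integral>\<^sup>+u. E \<rho> * indicator {norm u<..} \<rho> * g (x + h n *\<^sub>R u) \<partial>lborel) \<partial>lborel)"
      by (rule lborel_pair.Fubini') measurable
    also have "\<dots> = (\<integral>\<^sup>+\<rho>. E \<rho> * J n \<rho> \<partial>lborel)"
      unfolding J_def by (subst nn_integral_cmult[symmetric]) (auto simp: mult_ac)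
    finally show ?thesis .
  qed
  have "(\<lambda>n. \<integral>\<^sup>+\<rho>. E \<rho> * J n \<rho> \<partial>lborel) \<longlonglongrightarrow> (\<integral>\<^sup>+\<rho>. 0 \<partial>(lborel :: real measure))"
  proof (rule nn_integral_dominated_convergence[where w="\<lambda>\<rho>. ennreal C * ennreal (erlang_density 0 c \<rho> * \<rho> ^ DIM('a))"])
    show "(\<integral>\<^sup>+\<rho>. ennreal C * ennreal (erlang_density 0 c \<rho> * \<rho> ^ DIM('a)) \<partial>lborel) < \<infinity>"
      using c by (subst nn_integral_cmult) (auto simp: nn_integral_erlang_ith_moment ennreal_mult_less_top)
    show "AE \<rho> in lborel. E \<rho> * J n \<rho> \<le> ennreal C * ennreal (erlang_density 0 c \<rho> * \<rho> ^ DIM('a))" for n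
    proof (intro AE_I2)
      fix \<rho> :: real
      show "E \<rho> * J n \<rho> \<le> ennreal C * ennreal (erlang_density 0 c \<rho> * \<rho> ^ DIM('a))"
      proof (cases "\<rho> \<le> 0")
        case False
        then have "J n \<rho> \<le> ennreal (C * \<rho> ^ DIM('a))"
          using bound[of "h n * \<rho>"] h(1)[of n] C by (intro J_le) (auto simp: I_def)
        then have "E \<rho> * J n \<rho> \<le> E \<rho> * ennreal (C * \<rho> ^ DIM('a))" by (rule mult_left_mono) simp
        also have "\<dots> = ennreal C * ennreal (erlang_density 0 c \<rho> * \<rho> ^ DIM('a))"
          using C False c by (simp add: E_def ennreal_mult[symmetric] mult_ac)
        finally show ?thesis .
      qed (simp add: J0)
    qed
    show "AE \<rho> in lborel. (\<lambda>n. E \<rho> * J n \<rho>) \<longlonglongrightarrow> 0"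
    proof (intro AE_I2)
      fix \<rho> :: real
      have "(\<lambda>n. J n \<rho>) \<longlonglongrightarrow> 0"
      proof (cases "\<rho> \<le> 0")
        case False
        show ?thesis
        proof (rule order_tendstoI)
          fix y :: ennreal assume "0 < y"
          then obtain e where e: "0 < e" "ennreal e < y"
            by (metis dense ennreal_cases ennreal_less_zero_iff less_top_ennreal neq_top_trans order_less_imp_le)
          define e' where "e' = e / \<rho> ^ DIM('a)"
          have e': "0 < e'" using e False by (simp add: e'_def)
          from small[OF this] obtain d where d: "d > 0"
            "\<And>r. 0 < r \<Longrightarrow> r < d \<Longrightarrow> I r \<le> ennreal (e' * r ^ DIM('a))"
            unfolding I_def by auto
          have "(\<lambda>n. h n * \<rho>) \<longlonglongrightarrow> 0 * \<rho>" by (intro tendsto_intros h)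
          then have "eventually (\<lambda>n. h n * \<rho> < d) sequentially"
            using d(1) by (intro order_tendstoD(2)) auto
          then show "eventually (\<lambda>n. J n \<rho> < y) sequentially"
          proof eventually_elim
            case (elim n)
            have "J n \<rho> \<le> ennreal (e' * \<rho> ^ DIM('a))"
              using d(2)[of "h n * \<rho>"] elim h(1)[of n] False e' by (intro J_le) auto
            also have "\<dots> = ennreal e" using False by (simp add: e'_def)
            finally show ?case using e by simp
          qed
        qed simp
      qed (simp add: J0)
      then have "(\<lambda>n. E \<rho> * J n \<rho>) \<longlonglongrightarrow> E \<rho> * 0"
        by (intro tendsto_mult_ennreal tendsto_const) (auto simp: E_def)
      then show "(\<lambda>n. E \<rho> * J n \<rho>) \<longlonglongrightarrow> 0" by simp
    qed
  qed auto
  then show ?thesis unfolding * by simp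
qed

text \<open>Layer cake again: the integral is bounded by the unit ball volume times the d-th moment
  of the exponential law.\<close>

lemma integrable_exp_norm:
  assumes c: "0 < c"
  shows "integrable lborel (\<lambda>u::'a::euclidean_space. exp (- c * norm u))"
proof (rule integrableI_bounded)
  define E where "E \<rho> = ennreal (erlang_density 0 c \<rho>)" for \<rho>
  have [measurable]: "E \<in> borel_measurable borel"
    unfolding E_def[abs_def] by measurable
  have "(\<integral>\<^sup>+u. ennreal (norm (exp (- c * norm (u::'a)))) \<partial>lborel) =
      (\<integral>\<^sup>+u. (\<integral>\<^sup>+\<rho>. E \<rho> * indicator {norm (u::'a)<..} \<rho> \<partial>lborel) \<partial>lborel)"
    by (simp add: E_def nn_integral_exponential_tail[OF c])
  also have "\<dots> = (\<integral>\<^sup>+\<rho>. (\<integral>\<^sup>+u. E \<rho> * indicator {norm (u::'a)<..} \<rho> \<partial>lborel) \<partial>lborel)"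
    by (rule lborel_pair.Fubini') measurable
  also have "\<dots> \<le> (\<integral>\<^sup>+\<rho>. ennreal (unit_ball_vol DIM('a)) * ennreal (erlang_density 0 c \<rho> * \<rho> ^ DIM('a)) \<partial>lborel)"
  proof (intro nn_integral_mono)
    fix \<rho> :: real
    have "(\<integral>\<^sup>+u. E \<rho> * indicator {norm (u::'a)<..} \<rho> \<partial>lborel) = (\<integral>\<^sup>+u. E \<rho> * indicator (ball (0::'a) \<rho>) u \<partial>lborel)"
      by (intro nn_integral_cong) (auto simp: indicator_def)
    also have "\<dots> = E \<rho> * emeasure lborel (ball (0::'a) \<rho>)"
      by (rule nn_integral_cmult_indicator) simp
    also have "\<dots> \<le> ennreal (unit_ball_vol DIM('a)) * ennreal (erlang_density 0 c \<rho> * \<rho> ^ DIM('a))"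
      using c by (cases "\<rho> \<le> 0")
        (auto simp: ball_empty emeasure_ball E_def ennreal_mult[symmetric] mult_ac)
    finally show "(\<integral>\<^sup>+u. E \<rho> * indicator {norm (u::'a)<..} \<rho> \<partial>lborel) \<le>
      ennreal (unit_ball_vol DIM('a)) * ennreal (erlang_density 0 c \<rho> * \<rho> ^ DIM('a))" .
  qed
  also have "\<dots> < \<infinity>"
    using c by (subst nn_integral_cmult) (auto simp: nn_integral_erlang_ith_moment ennreal_mult_less_top)
  finally show "(\<integral>\<^sup>+u. ennreal (norm (exp (- c * norm (u::'a)))) \<partial>lborel) < \<infinity>" .
qed auto

section \<open>Scaling limits of integrals of powers\<close>

text \<open>For n \<ge> 2 the exponent n - 1 is at least n / 2. Halving the rate gives a bound in n
  * q alone, the quantity that survives rescaling.\<close>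

lemma one_minus_power_le_exp:
  fixes q :: real
  assumes "q \<le> 1" "0 \<le> q" "2 \<le> n"
  shows "(1 - q) ^ (n - 1) \<le> exp (- (real n * q) / 2)"
proof -
  have "(1 - q) ^ (n - 1) \<le> exp (- q) ^ (n - 1)"
    using assms exp_ge_add_one_self[of "-q"] by (intro power_mono) auto
  also have "\<dots> = exp (- (real (n - 1) * q))" by (simp add: exp_of_nat_mult[symmetric])
  also have "\<dots> \<le> exp (- (real n * q) / 2)"
  proof -
    have "real n / 2 \<le> real (n - 1)" using assms by auto
    then have "real n / 2 * q \<le> real (n - 1) * q" using assms by (intro mult_right_mono)
    then show ?thesis by simp
  qed
  finally show ?thesis .
qed

text \<open>In logarithms, ln (1 - q) is - q up to O(q^2), and (n - 1) * q^2 tends to 0 because n *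
  q converges while q tends to 0.\<close>

lemma tendsto_one_minus_power_exp:
  fixes q :: "nat \<Rightarrow> real"
  assumes q: "\<And>n. 0 \<le> q n" and lim: "(\<lambda>n. real n * q n) \<longlonglongrightarrow> l"
  shows "(\<lambda>n. (1 - q n) ^ (n - 1)) \<longlonglongrightarrow> exp (- l)"
proof -
  have "(\<lambda>n. real n * q n * (1 / real n)) \<longlonglongrightarrow> l * 0"
    by (intro tendsto_mult lim lim_1_over_n)
  moreover have "eventually (\<lambda>n. real n * q n * (1 / real n) = q n) sequentially"
    using eventually_gt_at_top[of 0] by eventually_elim auto
  ultimately have q0: "q \<longlonglongrightarrow> 0" by (simp add: tendsto_cong)
  have q2: "eventually (\<lambda>n. q n \<le> 1/2) sequentially"
    using order_tendstoD(2)[OF q0, of "1/2"] by (auto elim: eventually_mono)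
  have m: "(\<lambda>n. real (n - 1) * q n) \<longlonglongrightarrow> l"
  proof -
    have "(\<lambda>n. real n * q n - q n) \<longlonglongrightarrow> l - 0" by (intro tendsto_diff lim q0)
    moreover have "eventually (\<lambda>n. real n * q n - q n = real (n - 1) * q n) sequentially"
      using eventually_gt_at_top[of 0] by eventually_elim (auto simp: of_nat_diff algebra_simps)
    ultimately show ?thesis by (simp add: tendsto_cong)
  qed
  have "(\<lambda>n. real (n - 1) * ln (1 - q n) + real (n - 1) * q n) \<longlonglongrightarrow> 0"
  proof (rule Lim_null_comparison)
    show "eventually (\<lambda>n. norm (real (n - 1) * ln (1 - q n) + real (n - 1) * q n) \<le> 2 * (real (n - 1) * q n) * q n) sequentially"
      using q2
    proof eventually_elim
      case (elim n)
      have "\<bar>ln (1 + (- q n)) - (- q n)\<bar> \<le> 2 * (- q n)\<^sup>2"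
        using q[of n] elim by (intro abs_ln_one_plus_x_minus_x_bound) auto
      then have "real (n - 1) * \<bar>ln (1 - q n) + q n\<bar> \<le> real (n - 1) * (2 * (q n)\<^sup>2)"
        by (intro mult_left_mono) auto
      moreover have "real (n - 1) * ln (1 - q n) + real (n - 1) * q n = real (n - 1) * (ln (1 - q n) + q n)"
        by (simp add: distrib_left)
      ultimately show ?case
        by (simp add: abs_mult power2_eq_square mult_ac)
    qed
    have "(\<lambda>n. 2 * (real (n - 1) * q n) * q n) \<longlonglongrightarrow> 2 * l * 0" by (intro tendsto_intros m q0)
    then show "(\<lambda>n. 2 * (real (n - 1) * q n) * q n) \<longlonglongrightarrow> 0" by simp
  qed
  from tendsto_diff[OF this m] have "(\<lambda>n. real (n - 1) * ln (1 - q n)) \<longlonglongrightarrow> - l" by simp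
  then have "(\<lambda>n. exp (real (n - 1) * ln (1 - q n))) \<longlonglongrightarrow> exp (- l)" by (rule tendsto_exp)
  moreover have "eventually (\<lambda>n. exp (real (n - 1) * ln (1 - q n)) = (1 - q n) ^ (n - 1)) sequentially"
    using q2 by eventually_elim (simp add: exp_of_nat_mult)
  ultimately show ?thesis by (simp add: tendsto_cong)
qed

lemma tendsto_power_mult_geometric:
  fixes c :: real
  assumes "0 < c" "c \<le> 1"
  shows "(\<lambda>n. real n ^ k * (1 - c) ^ (n - 1)) \<longlonglongrightarrow> 0"
proof -
  have "(\<lambda>n. real n ^ k * exp (- (real n * c) / 2)) \<longlonglongrightarrow> 0"
    using assms(1) by real_asymp
  then show ?thesis
  proof (rule Lim_null_comparison[rotated])
    show "eventually (\<lambda>n. norm (real n ^ k * (1 - c) ^ (n - 1)) \<le> real n ^ k * exp (- (real n * c) / 2)) sequentially"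
      using eventually_ge_at_top[of 2]
      by eventually_elim (use assms one_minus_power_le_exp in \<open>auto simp: abs_mult intro!: mult_left_mono\<close>)
  qed
qed

lemma integral_lborel_affine:
  fixes x :: "'a::euclidean_space" and F :: "'a \<Rightarrow> real"
  assumes [measurable]: "F \<in> borel_measurable borel" and h: "0 < h"
  shows "(\<integral>y. F y \<partial>lborel) = h ^ DIM('a) * (\<integral>u. F (x + h *\<^sub>R u) \<partial>lborel)"
  using h by (subst lborel_affine[of h x]) (auto simp: integral_density integral_distr)

lemma integrable_lborel_affine:
  fixes x :: "'a::euclidean_space" and F :: "'a \<Rightarrow> real"
  assumes F: "integrable lborel F" and h: "0 < h"
  shows "integrable lborel (\<lambda>u. F (x + h *\<^sub>R u))"
proof -
  have [measurable]: "F \<in> borel_measurable borel" using F by auto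
  have "integrable (density (distr lborel borel (\<lambda>u. x + h *\<^sub>R u)) (\<lambda>_. \<bar>h\<bar> ^ DIM('a))) F"
    using F h by (subst lborel_affine[symmetric]) auto
  then show ?thesis
    using h by (subst (asm) integrable_density) (auto simp: integrable_distr_eq)
qed

text \<open>Common core of both moments: k is the order, g the density of the integration points, A
  its value at x, and q the probability that one sample point excludes them. By \<open>hn\<close>
  the factor n^k times the Jacobian of w = x + h u is 1 / A, so inside \<open>N\<close> the powers
  are integrated against g / A. They lie below G there, hence \<open>L1\<close> allows g / A to be
  replaced by 1, and dominated convergence yields exp (- l). Outside \<open>N\<close> geometric
  decay beats n^k.\<close>

lemma tendsto_scaled_integral_one_minus_power:
  fixes g q G l :: "'b::euclidean_space \<Rightarrow> real" and x :: 'b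
  assumes gm[measurable]: "g \<in> borel_measurable borel" and g0: "\<And>w. 0 \<le> g w"
    and gi: "integrable lborel g" "(\<integral>w. g w \<partial>lborel) \<le> 1"
    and qm[measurable]: "q \<in> borel_measurable borel" and q: "\<And>w. 0 \<le> q w" "\<And>w. q w \<le> 1"
    and h: "\<And>n. 0 < h n" and hn: "\<And>n. 0 < n \<Longrightarrow> real n ^ k * h n ^ DIM('b) * A = 1" and A: "0 < A"
    and Gi: "integrable lborel G" and G0: "\<And>u. 0 < G u"
    and L1: "(\<lambda>n. \<integral>\<^sup>+u. ennreal (G u * \<bar>g (x + h n *\<^sub>R u) / A - 1\<bar>) \<partial>lborel) \<longlonglongrightarrow> 0"
    and lm[measurable]: "l \<in> borel_measurable borel"
    and lim: "\<And>u. (\<lambda>n. real n * q (x + h n *\<^sub>R u)) \<longlonglongrightarrow> l u"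
    and N[measurable]: "N \<in> sets borel" and ev: "\<And>u. eventually (\<lambda>n. x + h n *\<^sub>R u \<in> N) sequentially"
    and near: "\<And>n u. 0 < n \<Longrightarrow> x + h n *\<^sub>R u \<in> N \<Longrightarrow> exp (- (real n * q (x + h n *\<^sub>R u)) / 2) \<le> G u"
    and far: "\<And>w. w \<notin> N \<Longrightarrow> c \<le> q w" "0 < c" "c \<le> 1"
  shows "(\<lambda>n. real n ^ k * (\<integral>w. g w * (1 - q w) ^ (n - 1) \<partial>lborel)) \<longlonglongrightarrow> (\<integral>u. exp (- l u) \<partial>lborel)"
proof -
  have [measurable]: "G \<in> borel_measurable borel" using Gi by auto
  define r where "r n u = indicator N (x + h n *\<^sub>R u) * (1 - q (x + h n *\<^sub>R u)) ^ (n - 1)" for n u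
  have [measurable]: "r n \<in> borel_measurable borel" for n
    unfolding r_def[abs_def] by measurable
  have pw: "0 \<le> (1 - q w) ^ n" "(1 - q w) ^ n \<le> 1" for w n
    using q[of w] by (auto intro!: power_le_one)
  have r0: "0 \<le> r n u" "r n u \<le> 1" for n u
    using pw by (auto simp: r_def indicator_def)
  have rG: "r n u \<le> G u" if "2 \<le> n" for n u
  proof (cases "x + h n *\<^sub>R u \<in> N")
    case True
    then show ?thesis
      using one_minus_power_le_exp[OF q(2,1) that] near[of n u] that
      by (auto simp: r_def intro: order_trans)
  qed (simp add: r_def less_imp_le[OF G0])
  have ri: "integrable lborel (r n)" if "2 \<le> n" for n
    by (rule Bochner_Integration.integrable_bound[OF Gi]) (use rG[OF that] r0 less_imp_le[OF G0] in auto)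
  have rgi: "integrable lborel (\<lambda>u. r n u * (g (x + h n *\<^sub>R u) / A))" for n
  proof (rule Bochner_Integration.integrable_bound)
    show "integrable lborel (\<lambda>u. g (x + h n *\<^sub>R u) / A)"
      using integrable_lborel_affine[OF gi(1) h] by simp
    show "AE u in lborel. norm (r n u * (g (x + h n *\<^sub>R u) / A)) \<le> norm (g (x + h n *\<^sub>R u) / A)"
      using r0 g0 A by (intro AE_I2) (simp add: abs_mult divide_le_cancel mult_left_le_one_le)
  qed auto
  have lim_r: "(\<lambda>n. \<integral>u. r n u \<partial>lborel) \<longlonglongrightarrow> (\<integral>u. exp (- l u) \<partial>lborel)"
  proof -
    \<comment> \<open>The shift by 2 is needed because G dominates only from n = 2 on, while
      dominated convergence asks for every index.\<close>
    have "(\<lambda>n. \<integral>u. r (n + 2) u \<partial>lborel) \<longlonglongrightarrow> (\<integral>u. exp (- l u) \<partial>lborel)"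
    proof (rule integral_dominated_convergence[OF _ _ Gi])
      show "AE u in lborel. norm (r (n + 2) u) \<le> G u" for n
        using rG[of "n + 2"] r0 by auto
      show "AE u in lborel. (\<lambda>n. r (n + 2) u) \<longlonglongrightarrow> exp (- l u)"
      proof (intro AE_I2)
        fix u
        have "(\<lambda>n. (1 - q (x + h n *\<^sub>R u)) ^ (n - 1)) \<longlonglongrightarrow> exp (- l u)"
          by (rule tendsto_one_minus_power_exp[OF q(1) lim])
        moreover have "eventually (\<lambda>n. (1 - q (x + h n *\<^sub>R u)) ^ (n - 1) = r n u) sequentially"
          using ev[of u] by eventually_elim (simp add: r_def)
        ultimately have "(\<lambda>n. r n u) \<longlonglongrightarrow> exp (- l u)" by (simp add: tendsto_cong)
        then show "(\<lambda>n. r (n + 2) u) \<longlonglongrightarrow> exp (- l u)" by (rule LIMSEQ_ignore_initial_segment)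
      qed
    qed auto
    then show ?thesis by (rule LIMSEQ_offset)
  qed
  \<comment> \<open>Replacement of g / A by 1: the error is at most the integral in
    \<open>L1\<close>, because r lies between 0 and G.\<close>
  have diff: "(\<lambda>n. (\<integral>u. r n u * (g (x + h n *\<^sub>R u) / A) \<partial>lborel) - (\<integral>u. r n u \<partial>lborel)) \<longlonglongrightarrow> 0" (is "?D \<longlonglongrightarrow> 0")
  proof -
    have "(\<lambda>n. ennreal (norm (?D n))) \<longlonglongrightarrow> 0"
    proof (rule tendsto_sandwich[OF _ _ tendsto_const L1])
      show "eventually (\<lambda>n. ennreal (norm (?D n)) \<le> (\<integral>\<^sup>+u. ennreal (G u * \<bar>g (x + h n *\<^sub>R u) / A - 1\<bar>) \<partial>lborel)) sequentially"
        using eventually_ge_at_top[of 2]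
      proof eventually_elim
        case (elim n)
        have "?D n = (\<integral>u. r n u * (g (x + h n *\<^sub>R u) / A) - r n u \<partial>lborel)"
          by (rule Bochner_Integration.integral_diff[symmetric, OF rgi ri[OF elim]])
        then have "ennreal (norm (?D n)) \<le> (\<integral>\<^sup>+u. ennreal (norm (r n u * (g (x + h n *\<^sub>R u) / A) - r n u)) \<partial>lborel)"
          using integral_norm_bound_ennreal[OF Bochner_Integration.integrable_diff[OF rgi ri[OF elim]]] by simp
        also have "\<dots> \<le> (\<integral>\<^sup>+u. ennreal (G u * \<bar>g (x + h n *\<^sub>R u) / A - 1\<bar>) \<partial>lborel)"
        proof (intro nn_integral_mono ennreal_leI)
          fix u
          have "norm (r n u * (g (x + h n *\<^sub>R u) / A) - r n u) = r n u * \<bar>g (x + h n *\<^sub>R u) / A - 1\<bar>"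
          proof -
            have "r n u * (g (x + h n *\<^sub>R u) / A) - r n u = r n u * (g (x + h n *\<^sub>R u) / A - 1)"
              by (simp add: right_diff_distrib)
            then show ?thesis using r0(1)[of n u] by (simp add: abs_mult)
          qed
          also have "\<dots> \<le> G u * \<bar>g (x + h n *\<^sub>R u) / A - 1\<bar>"
            by (intro mult_right_mono rG[OF elim]) auto
          finally show "norm (r n u * (g (x + h n *\<^sub>R u) / A) - r n u) \<le> G u * \<bar>g (x + h n *\<^sub>R u) / A - 1\<bar>" .
        qed
        finally show ?case .
      qed
    qed auto
    then have "(\<lambda>n. norm (?D n)) \<longlonglongrightarrow> 0"
      using tendsto_ennrealD[of "\<lambda>n. norm (?D n)" 0 sequentially] by simp
    then show ?thesis by (rule tendsto_norm_zero_cancel)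
  qed
  \<comment> \<open>The part outside \<open>N\<close>. Since g has total mass at most 1, it is at
    most n^k * (1 - c)^(n - 1).\<close>
  define F where "F n = real n ^ k * (\<integral>w. indicator (- N) w * (g w * (1 - q w) ^ (n - 1)) \<partial>lborel)" for n
  have gq: "integrable lborel (\<lambda>w. g w * (1 - q w) ^ (n - 1))" for n
    by (rule Bochner_Integration.integrable_bound[OF gi(1)])
      (use pw g0 in \<open>auto simp: abs_mult intro!: mult_left_le\<close>)
  have gqN: "integrable lborel (\<lambda>w. indicator S w * (g w * (1 - q w) ^ (n - 1)))" if "S \<in> sets borel" for n S
    using integrable_mult_indicator[OF _ gq, of S] that by simp
  have F0: "F \<longlonglongrightarrow> 0"
  proof (rule Lim_null_comparison)
    show "(\<lambda>n. real n ^ k * (1 - c) ^ (n - 1)) \<longlonglongrightarrow> 0"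
      using far by (intro tendsto_power_mult_geometric)
    show "eventually (\<lambda>n. norm (F n) \<le> real n ^ k * (1 - c) ^ (n - 1)) sequentially"
    proof (intro always_eventually allI)
      fix n
      have "(\<integral>w. indicator (- N) w * (g w * (1 - q w) ^ (n - 1)) \<partial>lborel) \<le> (\<integral>w. g w * (1 - c) ^ (n - 1) \<partial>lborel)"
      proof (rule integral_mono[OF gqN])
        fix w
        show "indicator (- N) w * (g w * (1 - q w) ^ (n - 1)) \<le> g w * (1 - c) ^ (n - 1)"
          using far g0[of w] q[of w]
          by (cases "w \<in> N") (auto intro!: mult_left_mono power_mono)
      qed (use gi in auto)
      also have "\<dots> \<le> 1 * (1 - c) ^ (n - 1)"
        using gi far by (simp, intro mult_left_le_one_le) (auto intro: Bochner_Integration.integral_nonneg g0)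
      finally have "F n \<le> real n ^ k * (1 - c) ^ (n - 1)"
        by (simp add: F_def mult_left_mono)
      moreover have "0 \<le> F n"
        using pw g0 by (auto simp: F_def intro!: mult_nonneg_nonneg Bochner_Integration.integral_nonneg)
      ultimately show "norm (F n) \<le> real n ^ k * (1 - c) ^ (n - 1)" by simp
    qed
  qed
  have "(\<lambda>n. (?D n + (\<integral>u. r n u \<partial>lborel)) + F n) \<longlonglongrightarrow> (0 + (\<integral>u. exp (- l u) \<partial>lborel)) + 0"
    by (intro tendsto_add diff lim_r F0)
  moreover have "eventually (\<lambda>n. (?D n + (\<integral>u. r n u \<partial>lborel)) + F n = real n ^ k * (\<integral>w. g w * (1 - q w) ^ (n - 1) \<partial>lborel)) sequentially"
    using eventually_gt_at_top[of 0]
  proof eventually_elim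
    case (elim n)
    have "(\<integral>w. g w * (1 - q w) ^ (n - 1) \<partial>lborel) =
      (\<integral>w. indicator N w * (g w * (1 - q w) ^ (n - 1)) + indicator (- N) w * (g w * (1 - q w) ^ (n - 1)) \<partial>lborel)"
      by (intro Bochner_Integration.integral_cong) (auto simp: indicator_def)
    also have "\<dots> = (\<integral>w. indicator N w * (g w * (1 - q w) ^ (n - 1)) \<partial>lborel)
      + (\<integral>w. indicator (- N) w * (g w * (1 - q w) ^ (n - 1)) \<partial>lborel)"
      by (intro Bochner_Integration.integral_add gqN) auto
    also have "(\<integral>w. indicator N w * (g w * (1 - q w) ^ (n - 1)) \<partial>lborel) =
      h n ^ DIM('b) * (\<integral>u. indicator N (x + h n *\<^sub>R u) * (g (x + h n *\<^sub>R u) * (1 - q (x + h n *\<^sub>R u)) ^ (n - 1)) \<partial>lborel)"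
      by (rule integral_lborel_affine[OF _ h]) measurable
    also have "(\<integral>u. indicator N (x + h n *\<^sub>R u) * (g (x + h n *\<^sub>R u) * (1 - q (x + h n *\<^sub>R u)) ^ (n - 1)) \<partial>lborel)
      = (\<integral>u. A * (r n u * (g (x + h n *\<^sub>R u) / A)) \<partial>lborel)"
      using A by (intro Bochner_Integration.integral_cong) (auto simp: r_def)
    also have "\<dots> = A * (\<integral>u. r n u * (g (x + h n *\<^sub>R u) / A) \<partial>lborel)" by simp
    finally have "real n ^ k * (\<integral>w. g w * (1 - q w) ^ (n - 1) \<partial>lborel) =
      (real n ^ k * h n ^ DIM('b) * A) * (\<integral>u. r n u * (g (x + h n *\<^sub>R u) / A) \<partial>lborel) + F n"
      by (simp add: F_def algebra_simps)
    then show ?case using hn[OF elim] by simp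
  qed
  ultimately show ?thesis by (simp add: tendsto_cong)
qed

section \<open>Volume of the union of two balls touching the origin\<close>

text \<open>
  The library's \<open>measure_orthogonal_image\<close> needs a well-ordered index type. Instead, fill an open set
  up to a null set by disjoint balls, whose volume an orthogonal map preserves; applying the
  inequality to the map and to its inverse gives equality.
\<close>

lemma emeasure_open_le_vimage_orthogonal:
  fixes T :: "'a::euclidean_space \<Rightarrow> 'a"
  assumes T: "orthogonal_transformation T" and U: "open U"
  shows "emeasure lborel U \<le> emeasure lborel (T -` U)"
proof -
  define K where "K = {i. 0 < snd i \<and> ball (fst i) (snd i) \<subseteq> U}"
  have cov: "\<exists>i. i \<in> K \<and> x \<in> ball (fst i) (snd i) \<and> snd i < d" if x: "x \<in> U" "0 < d" for x d
  proof -
    obtain e where e: "0 < e" "ball x e \<subseteq> U" using U x openE by blast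
    have "ball x (min e (d/2)) \<subseteq> U" using e(2) by (meson min.cobounded1 subset_ball order_trans)
    then show ?thesis using e x unfolding K_def
      by (intro exI[of _ "(x, min e (d/2))"]) auto
  qed
  obtain C where C: "countable C" "C \<subseteq> K"
    "pairwise (\<lambda>i j. disjnt (ball (fst i) (snd i)) (ball (fst j) (snd j))) C"
    "negligible (U - (\<Union>i\<in>C. ball (fst i) (snd i)))"
    by (rule Vitali_covering_theorem_balls[where S=U and K=K and a=fst and r=snd]) (rule cov)
  let ?B = "\<lambda>i. ball (fst i) (snd i)"
  let ?V = "\<Union>i\<in>C. ?B i"
  have disj: "disjoint_family_on ?B C"
    using C(3) by (auto simp: disjoint_family_on_def pairwise_def disjnt_def)
  have V: "open ?V" "?V \<subseteq> U" using C(2) by (auto simp: K_def)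
  have "U - ?V \<in> null_sets lborel"
    using C(4) U V(1) by (simp add: negligible_iff_null_sets null_sets_completion_iff)
  then have "emeasure lborel (?V \<union> (U - ?V)) = emeasure lborel ?V"
    using V by (intro emeasure_Un_null_set) auto
  moreover have "?V \<union> (U - ?V) = U" using V by auto
  ultimately have "emeasure lborel U = emeasure lborel ?V" by simp
  also have "\<dots> = (\<integral>\<^sup>+i. emeasure lborel (?B i) \<partial>count_space C)"
    using C(1) disj by (intro emeasure_UN_countable) auto
  also have "\<dots> = (\<integral>\<^sup>+i. emeasure lborel (T -` ?B i) \<partial>count_space C)"
  proof (intro nn_integral_cong)
    fix i assume "i \<in> space (count_space C)"
    then have "0 < snd i" using C(2) by (auto simp: K_def)
    have "T -` ?B i = ball (inv T (fst i)) (snd i)"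
      using T orthogonal_transformation_surj[OF T]
      by (auto simp: orthogonal_transformation_isometry) (metis surj_f_inv_f)+
    then show "emeasure lborel (?B i) = emeasure lborel (T -` ?B i)"
      using \<open>0 < snd i\<close> by (simp add: emeasure_ball)
  qed
  also have "\<dots> = emeasure lborel (\<Union>i\<in>C. T -` ?B i)"
  proof (rule emeasure_UN_countable[symmetric])
    have "continuous_on UNIV T"
      using T by (intro linear_continuous_on linear_linear[THEN iffD2] orthogonal_transformation_linear)
    then show "T -` ?B i \<in> sets lborel" for i
      using open_vimage[of "?B i" T] by simp
    show "disjoint_family_on (\<lambda>i. T -` ?B i) C"
      using disj unfolding disjoint_family_on_def by (simp add: vimage_Int[symmetric])
  qed (rule C)
  also have "\<dots> \<le> emeasure lborel (T -` U)"
  proof (rule emeasure_mono)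
    have "continuous_on UNIV T"
      using T by (intro linear_continuous_on linear_linear[THEN iffD2] orthogonal_transformation_linear)
    then show "T -` U \<in> sets lborel" using open_vimage[of U T] U by simp
  qed (use V in auto)
  finally show ?thesis .
qed

lemma lborel_distr_orthogonal:
  fixes T :: "'a::euclidean_space \<Rightarrow> 'a"
  assumes T: "orthogonal_transformation T"
  shows "distr lborel borel T = lborel"
proof (rule lborel_eqI[symmetric])
  have c: "continuous_on UNIV T"
    using T by (intro linear_continuous_on linear_linear[THEN iffD2] orthogonal_transformation_linear)
  have [measurable]: "T \<in> borel_measurable borel" using c by (rule borel_measurable_continuous_onI)
  fix l u :: 'a assume lu: "\<And>b. b \<in> Basis \<Longrightarrow> l \<bullet> b \<le> u \<bullet> b"
  have "emeasure (distr lborel borel T) (box l u) = emeasure lborel (T -` box l u)"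
    by (subst emeasure_distr) auto
  also have "\<dots> = emeasure lborel (box l u)"
  proof (rule antisym)
    have "emeasure lborel (T -` box l u) \<le> emeasure lborel (inv T -` T -` box l u)"
      using c by (intro emeasure_open_le_vimage_orthogonal orthogonal_transformation_inv T open_vimage open_box)
    also have "inv T -` T -` box l u = box l u"
      using orthogonal_transformation_surj[OF T] by (simp add: vimage_def surj_f_inv_f)
    finally show "emeasure lborel (T -` box l u) \<le> emeasure lborel (box l u)" .
  qed (intro emeasure_open_le_vimage_orthogonal T open_box)
  also have "\<dots> = (\<Prod>b\<in>Basis. (u - l) \<bullet> b)" by (simp add: lu)
  finally show "emeasure (distr lborel borel T) (box l u) = (\<Prod>b\<in>Basis. (u - l) \<bullet> b)" .
qed simp

text \<open>Polar integration with the volume of the centred ball through u as radial variable: its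
  sublevel set at a \<ge> 0 is a ball of volume exactly a, so both measures agree on the half-lines
  that generate the Borel sets.\<close>

lemma distr_lborel_norm_power:
  "distr lborel borel (\<lambda>u::'a::euclidean_space. unit_ball_vol DIM('a) * norm u ^ DIM('a)) =
    density lborel (indicator {0..})" (is "?M = ?N")
proof (rule measure_eqI_generator_eq)
  let ?E = "range (\<lambda>a::real. {..a})"
  let ?V = "unit_ball_vol (real DIM('a))"
  show "Int_stable ?E" by (auto simp: Int_stable_def)
  show "sets ?M = sigma_sets UNIV ?E" "sets ?N = sigma_sets UNIV ?E"
    by (simp_all add: borel_eq_atMost)
  have V: "0 < ?V" by simp
  have M: "emeasure ?M {..a} = ennreal a" for a
  proof (cases "a \<ge> 0")
    case True
    define r where "r = root DIM('a) (a / ?V)"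
    have r: "0 \<le> r" "r ^ DIM('a) = a / ?V" using True V by (simp_all add: r_def)
    have "?V * norm u ^ DIM('a) \<le> a \<longleftrightarrow> u \<in> cball 0 r" for u :: 'a
    proof -
      have "?V * norm u ^ DIM('a) \<le> a \<longleftrightarrow> norm u ^ DIM('a) \<le> r ^ DIM('a)"
        unfolding r using V by (simp add: field_simps)
      also have "\<dots> \<longleftrightarrow> u \<in> cball 0 r"
        using power_mono_iff[OF norm_ge_zero r(1) DIM_positive] by simp
      finally show ?thesis .
    qed
    then have "(\<lambda>u::'a. ?V * norm u ^ DIM('a)) -` {..a} = cball 0 r" by auto
    then have "emeasure ?M {..a} = emeasure lborel (cball (0::'a) r)"
      by (subst emeasure_distr) auto
    also have "\<dots> = ennreal (?V * r ^ DIM('a))" by (rule emeasure_cball[OF r(1)])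
    also have "?V * r ^ DIM('a) = a" unfolding r(2) using less_imp_neq[OF V] by simp
    finally show ?thesis .
  next
    case False
    moreover have "0 \<le> ?V * norm u ^ DIM('a)" for u :: 'a by simp
    ultimately have "\<not> ?V * norm u ^ DIM('a) \<le> a" for u :: 'a by (meson order_trans)
    then have "(\<lambda>u::'a. ?V * norm u ^ DIM('a)) -` {..a} = {}" by blast
    then show ?thesis using False by (subst emeasure_distr) (auto simp: ennreal_neg)
  qed
  have N: "emeasure ?N {..a} = ennreal a" for a
  proof -
    have "emeasure ?N {..a} = (\<integral>\<^sup>+t. indicator {0..a} t \<partial>lborel)"
      by (subst emeasure_density) (auto intro!: nn_integral_cong simp del: nn_integral_indicator split: split_indicator)
    also have "\<dots> = ennreal a" by (cases "0 \<le> a") (auto simp: ennreal_neg)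
    finally show ?thesis .
  qed
  show "emeasure ?M X = emeasure ?N X" if "X \<in> ?E" for X using that M N by auto
  show "range (\<lambda>i. {..real i}) \<subseteq> ?E" by auto
  show "(\<Union>i. {..real i}) = UNIV" by (auto intro: real_arch_simple)
  show "emeasure ?M {..real i} \<noteq> \<infinity>" for i unfolding M by simp
qed simp

lemma nn_integral_radial:
  assumes [measurable]: "p \<in> borel_measurable borel"
  shows "(\<integral>\<^sup>+u. p (unit_ball_vol DIM('a) * norm (u::'a::euclidean_space) ^ DIM('a)) \<partial>lborel) =
    (\<integral>\<^sup>+t. p t * indicator {0..} t \<partial>lborel)"
proof -
  have "(\<integral>\<^sup>+u. p (unit_ball_vol DIM('a) * norm (u::'a) ^ DIM('a)) \<partial>lborel) =
    nn_integral (distr lborel borel (\<lambda>u::'a. unit_ball_vol DIM('a) * norm u ^ DIM('a))) p"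
    by (subst nn_integral_distr) auto
  also have "\<dots> = (\<integral>\<^sup>+t. indicator {0..} t * p t \<partial>lborel)"
    unfolding distr_lborel_norm_power by (rule nn_integral_density) auto
  finally show ?thesis by (simp add: mult.commute)
qed

text \<open>In the volume variable this is the integral of exp (- t) over the half-line. It is the
  limit of the first moment.\<close>

lemma nn_integral_exp_ball_volume:
  "(\<integral>\<^sup>+u. ennreal (exp (- (unit_ball_vol DIM('a) * norm (u::'a::euclidean_space) ^ DIM('a)))) \<partial>lborel) = 1"
proof -
  have "(\<integral>\<^sup>+u. ennreal (exp (- (unit_ball_vol DIM('a) * norm (u::'a) ^ DIM('a)))) \<partial>lborel)
    = (\<integral>\<^sup>+t. ennreal (exp (- t)) * indicator {0..} t \<partial>lborel)"
    by (rule nn_integral_radial[where p="\<lambda>t. ennreal (exp (- t))"]) measurable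
  also have "\<dots> = 1" using nn_intergal_power_times_exp_Ici[of 0] by simp
  finally show ?thesis .
qed

text \<open>Source of the square of W: in the variable t = V * norm u ^ d the integrand becomes t /
  V * exp (- t * w), which is 1 / (V * w^2) times the density \<open>erlang_density 1 w\<close> of
  total mass 1.\<close>

lemma nn_integral_norm_power_exp:
  assumes w: "0 < w"
  shows "(\<integral>\<^sup>+u. ennreal (norm (u::'a::euclidean_space) ^ DIM('a) *
      exp (- (unit_ball_vol DIM('a) * norm u ^ DIM('a) * w))) \<partial>lborel) =
    ennreal (1 / (unit_ball_vol DIM('a) * w\<^sup>2))"
proof -
  let ?V = "unit_ball_vol (real DIM('a))"
  have V: "0 < ?V" by simp
  have "(\<integral>\<^sup>+u. ennreal (norm (u::'a) ^ DIM('a) * exp (- (?V * norm u ^ DIM('a) * w))) \<partial>lborel) =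
    (\<integral>\<^sup>+u. ennreal ((?V * norm (u::'a) ^ DIM('a)) / ?V * exp (- (?V * norm u ^ DIM('a) * w))) \<partial>lborel)"
    by (subst nonzero_mult_div_cancel_left) (use less_imp_neq[OF V] in auto)
  also have "\<dots> = (\<integral>\<^sup>+t. ennreal (t / ?V * exp (- (t * w))) * indicator {0..} t \<partial>lborel)"
    by (rule nn_integral_radial[where p="\<lambda>t. ennreal (t / ?V * exp (- (t * w)))"]) measurable
  also have "\<dots> = (\<integral>\<^sup>+t. ennreal (1 / (?V * w\<^sup>2)) * ennreal (erlang_density 1 w t * t ^ 0) \<partial>lborel)"
    using w V by (intro nn_integral_cong)
      (auto simp: erlang_density_def indicator_def ennreal_mult'[symmetric] power2_eq_square mult_ac)
  also have "\<dots> = ennreal (1 / (?V * w\<^sup>2)) * (\<integral>\<^sup>+t. ennreal (erlang_density 1 w t * t ^ 0) \<partial>lborel)"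
    by (rule nn_integral_cmult) simp
  also have "(\<integral>\<^sup>+t. ennreal (erlang_density 1 w t * t ^ 0) \<partial>lborel) = 1"
    by (subst nn_integral_erlang_ith_moment[OF w]) simp
  finally show ?thesis by simp
qed


text \<open>Limit of n times the measure of the excluded region, in rescaled coordinates with x at
  the origin. The balls are open, as in \<open>voronoi_cell_first\<close>, whereas
  \<open>ball_ratio\<close> is stated with closed ones.\<close>

definition two_balls_volume :: "'a::euclidean_space \<Rightarrow> 'a \<Rightarrow> real" where
  "two_balls_volume u v = measure lborel (ball u (norm u) \<union> ball v (norm v))"

lemma emeasure_two_balls:
  "emeasure lborel (ball u (norm u) \<union> ball v (norm v)) = ennreal (two_balls_volume u v)"
  unfolding two_balls_volume_def
  by (rule emeasure_eq_ennreal_measure)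
    (use emeasure_bounded_finite[of "ball u (norm u) \<union> ball v (norm v)"] in \<open>simp add: less_top\<close>)

lemma two_balls_volume_commute: "two_balls_volume u v = two_balls_volume v u"
  by (simp add: two_balls_volume_def Un_commute)

lemma two_balls_volume_nonneg[simp]: "0 \<le> two_balls_volume u v"
  by (simp add: two_balls_volume_def)

lemma two_balls_volume_same: "two_balls_volume u u = unit_ball_vol DIM('a) * norm u ^ DIM('a)"
  for u :: "'a::euclidean_space"
  by (simp add: two_balls_volume_def content_ball)

lemma two_balls_volume_ge: "two_balls_volume u u \<le> two_balls_volume u v"
proof -
  have "ennreal (two_balls_volume u u) \<le> ennreal (two_balls_volume u v)"
    unfolding emeasure_two_balls[symmetric] by (intro emeasure_mono) auto
  then show ?thesis by simp
qed

text \<open>The centre is general because \<open>scaled_hit_tendsto\<close> needs it at the fixed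
  sample point; centre 0 gives homogeneity of degree d.\<close>

lemma emeasure_two_balls_affine:
  fixes x :: "'a::euclidean_space"
  assumes h: "0 < h"
  shows "emeasure lborel (ball (x + h *\<^sub>R u) (h * norm u) \<union> ball (x + h *\<^sub>R v) (h * norm v))
    = ennreal (h ^ DIM('a) * two_balls_volume u v)"
proof -
  let ?S = "ball (x + h *\<^sub>R u) (h * norm u) \<union> ball (x + h *\<^sub>R v) (h * norm v)"
  have m: "?S \<in> sets borel" by simp
  have "emeasure lborel ?S = (\<integral>\<^sup>+y. indicator ?S y \<partial>lborel)" using m by simp
  also have "\<dots> = ennreal (h ^ DIM('a)) * (\<integral>\<^sup>+w. indicator ?S (x + h *\<^sub>R w) \<partial>lborel)"
    using m h by (intro nn_integral_lborel_affine borel_measurable_indicator)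
  also have "(\<lambda>w. indicator ?S (x + h *\<^sub>R w) :: ennreal) = indicator (ball u (norm u) \<union> ball v (norm v))"
  proof -
    have "dist (x + h *\<^sub>R a) (x + h *\<^sub>R w) = h * dist a w" for a w :: 'a
      using h by (simp add: dist_norm flip: scaleR_diff_right)
    then show ?thesis using h by (auto simp: indicator_def)
  qed
  also have "(\<integral>\<^sup>+w. indicator (ball u (norm u) \<union> ball v (norm v)) w \<partial>lborel) = ennreal (two_balls_volume u v)"
    by (subst nn_integral_indicator) (auto simp: emeasure_two_balls)
  finally show ?thesis using h by (simp add: ennreal_mult)
qed

lemma two_balls_volume_scaleR:
  fixes u :: "'a::euclidean_space"
  assumes h: "0 < h"
  shows "two_balls_volume (h *\<^sub>R u) (h *\<^sub>R v) = h ^ DIM('a) * two_balls_volume u v"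
proof -
  have "ennreal (two_balls_volume (h *\<^sub>R u) (h *\<^sub>R v)) = ennreal (h ^ DIM('a) * two_balls_volume u v)"
    using h emeasure_two_balls_affine[OF h, of 0 u v] unfolding emeasure_two_balls[symmetric] by simp
  then show ?thesis using h by simp
qed

lemma two_balls_volume_orthogonal:
  fixes T :: "'a::euclidean_space \<Rightarrow> 'a"
  assumes T: "orthogonal_transformation T"
  shows "two_balls_volume (T u) (T v) = two_balls_volume u v"
proof -
  have c: "continuous_on UNIV T"
    using T by (intro linear_continuous_on linear_linear[THEN iffD2] orthogonal_transformation_linear)
  have [measurable]: "T \<in> borel_measurable borel" using c by (rule borel_measurable_continuous_onI)
  have "ennreal (two_balls_volume (T u) (T v)) =
    emeasure (distr lborel borel T) (ball (T u) (norm (T u)) \<union> ball (T v) (norm (T v)))"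
    unfolding lborel_distr_orthogonal[OF T] emeasure_two_balls ..
  also have "\<dots> = emeasure lborel (T -` (ball (T u) (norm (T u)) \<union> ball (T v) (norm (T v))))"
    by (subst emeasure_distr) auto
  also have "T -` (ball (T u) (norm (T u)) \<union> ball (T v) (norm (T v))) = ball u (norm u) \<union> ball v (norm v)"
    using T by (auto simp: orthogonal_transformation_isometry orthogonal_transformation_norm)
  finally show ?thesis by (simp add: emeasure_two_balls)
qed

text \<open>These are the measures of the sections of a single measurable set in the product of N
  and \<nu>. Keeping \<nu> general covers both Lebesgue measure and \<mu>.\<close>

lemma borel_measurable_measure_two_balls:
  fixes x :: "'a::euclidean_space"
  assumes "sigma_finite_measure \<nu>" and sets[measurable_cong]: "sets \<nu> = sets borel"
    and [measurable]: "g \<in> borel_measurable N" "h \<in> borel_measurable N"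
  shows "(\<lambda>w. measure \<nu> (ball (g w) (dist (g w) x) \<union> ball (h w) (dist (h w) x))) \<in> borel_measurable N"
proof -
  interpret sigma_finite_measure \<nu> by fact
  have sp: "space \<nu> = UNIV" using sets_eq_imp_space_eq[OF sets] by simp
  have "{p \<in> space (N \<Otimes>\<^sub>M \<nu>). snd p \<in> ball (g (fst p)) (dist (g (fst p)) x) \<union> ball (h (fst p)) (dist (h (fst p)) x)}
     \<in> sets (N \<Otimes>\<^sub>M \<nu>)"
    unfolding mem_ball Un_iff by measurable
  then have [measurable]: "(\<lambda>w. emeasure \<nu> (ball (g w) (dist (g w) x) \<union> ball (h w) (dist (h w) x))) \<in> borel_measurable N"
    by (intro measurable_emeasure) (auto simp: sp)
  show ?thesis unfolding measure_def by measurable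
qed

lemma borel_measurable_two_balls_volume[measurable]:
  assumes "g \<in> borel_measurable N" "h \<in> borel_measurable N"
  shows "(\<lambda>w. two_balls_volume (g w) (h w)) \<in> borel_measurable N"
  using borel_measurable_measure_two_balls[OF sigma_finite_lborel _ assms, of 0]
  by (simp add: two_balls_volume_def)

section \<open>The constant\<close>

lemma borel_measurable_fst_snd[measurable]:
  "fst \<in> borel_measurable (borel :: ('a::euclidean_space \<times> 'b::euclidean_space) measure)"
  "snd \<in> borel_measurable (borel :: ('a::euclidean_space \<times> 'b::euclidean_space) measure)"
  by (auto intro!: borel_measurable_continuous_onI continuous_intros)

lemma norm_one_vec[simp]: "norm (one_vec :: real ^ 'd) = 1"
  by (simp add: one_vec_def)

lemma unit_ball_vol_DIM: "measure lborel (cball (0::'a::euclidean_space) 1) = unit_ball_vol DIM('a)"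
  by (simp add: content_cball)

text \<open>Closed and open balls differ by spheres, which are negligible; as \<open>one_vec\<close>
  has norm 1, its ball passes through the origin.\<close>

lemma ball_ratio_eq:
  fixes w :: "real ^ 'd"
  shows "ball_ratio w = two_balls_volume one_vec w / unit_ball_vol DIM(real ^ 'd)"
proof -
  let ?B = "ball (one_vec :: real ^ 'd) 1 \<union> ball w (norm w)"
  let ?C = "cball (one_vec :: real ^ 'd) 1 \<union> cball w (norm w)"
  have "negligible (sphere (one_vec :: real ^ 'd) 1 \<union> sphere w (norm w))"
    by (intro negligible_Un negligible_sphere)
  moreover have "(?B - ?C) \<union> (?C - ?B) \<subseteq> sphere (one_vec :: real ^ 'd) 1 \<union> sphere w (norm w)"
    by auto
  ultimately have "negligible ((?B - ?C) \<union> (?C - ?B))" by (rule negligible_subset)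
  then have "measure lebesgue ?C = measure lebesgue ?B"
    by (intro measure_negligible_symdiff) auto
  then show ?thesis
    by (simp add: ball_ratio_def two_balls_volume_def unit_ball_vol_DIM)
qed

lemma ball_ratio_ge_1: "1 \<le> ball_ratio w"
  for w :: "real ^ 'd"
  using two_balls_volume_ge[of "one_vec :: real ^ 'd" w]
  by (simp add: ball_ratio_eq two_balls_volume_same)

lemma borel_measurable_ball_ratio[measurable]:
  "(ball_ratio :: real ^ 'd \<Rightarrow> real) \<in> borel_measurable borel"
  unfolding ball_ratio_eq[abs_def] by measurable

text \<open>In extended non-negative form the later Tonelli and substitution steps carry no
  integrability conditions. The normalisation 1 / V of the uniform law moves inside, to meet the
  same factor in \<open>nn_integral_norm_power_exp\<close>.\<close>

lemma alpha_eq_nn_integral: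
  "alpha TYPE('d::finite) = enn2real (\<integral>\<^sup>+w. ennreal (2 / (unit_ball_vol DIM(real ^ 'd) * (ball_ratio w)\<^sup>2)) *
     indicator (cball (0 :: real ^ 'd) 1) w \<partial>lborel)"
proof -
  let ?V = "unit_ball_vol (real DIM(real ^ 'd))"
  have "alpha TYPE('d) = enn2real (\<integral>\<^sup>+y. ennreal (2 / (ball_ratio y)\<^sup>2) \<partial>uniform_measure lborel (cball (0 :: real ^ 'd) 1))"
    unfolding alpha_def by (intro integral_eq_nn_integral) auto
  also have "(\<integral>\<^sup>+y. ennreal (2 / (ball_ratio y)\<^sup>2) \<partial>uniform_measure lborel (cball (0 :: real ^ 'd) 1))
    = (\<integral>\<^sup>+y. ennreal (2 / (ball_ratio y)\<^sup>2) * indicator (cball (0 :: real ^ 'd) 1) y \<partial>lborel) / emeasure lborel (cball (0 :: real ^ 'd) 1)"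
    by (rule nn_integral_uniform_measure) auto
  also have "emeasure lborel (cball (0 :: real ^ 'd) 1) = ennreal ?V"
    by (simp add: emeasure_cball)
  also have "(\<integral>\<^sup>+y. ennreal (2 / (ball_ratio y)\<^sup>2) * indicator (cball (0 :: real ^ 'd) 1) y \<partial>lborel) / ennreal ?V
    = (\<integral>\<^sup>+y. ennreal (2 / (ball_ratio y)\<^sup>2) * indicator (cball (0 :: real ^ 'd) 1) y / ennreal ?V \<partial>lborel)"
    by (rule nn_integral_divide[symmetric]) (auto intro!: borel_measurable_times_ennreal borel_measurable_indicator)
  also have "\<dots> = (\<integral>\<^sup>+w. ennreal (2 / (?V * (ball_ratio w)\<^sup>2)) * indicator (cball (0 :: real ^ 'd) 1) w \<partial>lborel)"
  proof (intro nn_integral_cong)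
    fix w :: "real ^ 'd"
    have "ennreal (2 / (ball_ratio w)\<^sup>2) / ennreal ?V = ennreal (2 / (ball_ratio w)\<^sup>2 / ?V)"
      by (rule divide_ennreal) simp_all
    also have "2 / (ball_ratio w)\<^sup>2 / ?V = 2 / (?V * (ball_ratio w)\<^sup>2)" by (simp only: divide_divide_eq_left mult.commute)
    finally show "ennreal (2 / (ball_ratio w)\<^sup>2) * indicator (cball (0 :: real ^ 'd) 1) w / ennreal ?V
      = ennreal (2 / (?V * (ball_ratio w)\<^sup>2)) * indicator (cball (0 :: real ^ 'd) 1) w"
      by (cases "w \<in> cball 0 1") simp_all
  qed
  finally show ?thesis .
qed

text \<open>Putting v = norm u * w, the factor \<open>norm u ^ d\<close> is the Jacobian, and
  homogeneity places the same power in the exponent. A rotation taking \<open>one_vec\<close> to u /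
  norm u then removes the direction of u.\<close>

lemma nn_integral_exp_two_balls_inner:
  fixes u :: "real ^ 'd"
  assumes u: "u \<noteq> 0"
  shows "(\<integral>\<^sup>+v. ennreal (exp (- two_balls_volume u v)) * indicator (cball 0 (norm u)) v \<partial>lborel) =
    (\<integral>\<^sup>+w. ennreal (norm u ^ DIM(real ^ 'd) * exp (- (norm u ^ DIM(real ^ 'd) * two_balls_volume one_vec w))) *
       indicator (cball (0 :: real ^ 'd) 1) w \<partial>lborel)"
proof -
  let ?n = "norm u ^ DIM(real ^ 'd)"
  obtain T :: "real ^ 'd \<Rightarrow> real ^ 'd" where T: "orthogonal_transformation T" "T one_vec = u /\<^sub>R norm u"
    by (rule orthogonal_transformation_exists[of one_vec "u /\<^sub>R norm u"]) (use u in auto)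
  have [measurable]: "T \<in> borel_measurable borel"
    using T(1) by (intro borel_measurable_continuous_onI linear_continuous_on linear_linear[THEN iffD2] orthogonal_transformation_linear)
  have "(\<integral>\<^sup>+v. ennreal (exp (- two_balls_volume u v)) * indicator (cball 0 (norm u)) v \<partial>lborel) =
    ennreal ?n * (\<integral>\<^sup>+w. ennreal (exp (- two_balls_volume u (0 + norm u *\<^sub>R w))) * indicator (cball 0 (norm u)) (0 + norm u *\<^sub>R w) \<partial>lborel)"
    by (rule nn_integral_lborel_affine) (use u in \<open>auto intro!: borel_measurable_times_ennreal borel_measurable_indicator\<close>)
  also have "(\<integral>\<^sup>+w. ennreal (exp (- two_balls_volume u (0 + norm u *\<^sub>R w))) * indicator (cball 0 (norm u)) (0 + norm u *\<^sub>R w) \<partial>lborel)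
    = (\<integral>\<^sup>+w. ennreal (exp (- (?n * two_balls_volume (T one_vec) w))) * indicator (cball 0 1) w \<partial>lborel)"
  proof (intro nn_integral_cong)
    fix w :: "real ^ 'd"
    have "two_balls_volume u (norm u *\<^sub>R w) = two_balls_volume (norm u *\<^sub>R T one_vec) (norm u *\<^sub>R w)"
      using u T by simp
    also have "\<dots> = ?n * two_balls_volume (T one_vec) w"
      using u by (intro two_balls_volume_scaleR) auto
    finally have "two_balls_volume u (norm u *\<^sub>R w) = ?n * two_balls_volume (T one_vec) w" .
    moreover have "norm u *\<^sub>R w \<in> cball 0 (norm u) \<longleftrightarrow> w \<in> cball 0 1"
      using u by simp
    ultimately show "ennreal (exp (- two_balls_volume u (0 + norm u *\<^sub>R w))) * indicator (cball 0 (norm u)) (0 + norm u *\<^sub>R w)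
      = ennreal (exp (- (?n * two_balls_volume (T one_vec) w))) * indicator (cball 0 1) w"
      by (simp add: indicator_def)
  qed
  \<comment> \<open>Lebesgue measure is written as its own image under \<open>T\<close>, which
    amounts to substituting T w for w; the unit ball is preserved.\<close>
  also have "\<dots> = (\<integral>\<^sup>+w. ennreal (exp (- (?n * two_balls_volume (T one_vec) w))) * indicator (cball 0 1) w \<partial>distr lborel borel T)"
    unfolding lborel_distr_orthogonal[OF T(1)] ..
  also have "\<dots> = (\<integral>\<^sup>+w. ennreal (exp (- (?n * two_balls_volume (T one_vec) (T w)))) * indicator (cball 0 1) (T w) \<partial>lborel)"
    by (rule nn_integral_distr) (auto intro!: borel_measurable_times_ennreal borel_measurable_indicator)
  also have "\<dots> = (\<integral>\<^sup>+w. ennreal (exp (- (?n * two_balls_volume one_vec w))) * indicator (cball (0 :: real ^ 'd) 1) w \<partial>lborel)"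
    unfolding two_balls_volume_orthogonal[OF T(1)]
    by (intro nn_integral_cong) (simp add: indicator_def orthogonal_transformation_norm[OF T(1)])
  also have "ennreal ?n * \<dots> = (\<integral>\<^sup>+w. ennreal ?n * (ennreal (exp (- (?n * two_balls_volume one_vec w))) * indicator (cball (0 :: real ^ 'd) 1) w) \<partial>lborel)"
    by (rule nn_integral_cmult[symmetric]) (auto intro!: borel_measurable_times_ennreal borel_measurable_indicator)
  finally show ?thesis
    by (simp only: ennreal_mult[OF zero_le_power[OF norm_ge_zero] less_imp_le[OF exp_gt_zero]] mult.assoc)
qed

text \<open>Tonelli makes u the inner variable, and for fixed w
  \<open>nn_integral_norm_power_exp\<close> applies at the positive number
  \<open>ball_ratio w\<close>. The point u = 0, which has no direction, is null.\<close>

lemma nn_integral_exp_two_balls_half: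
  "(\<integral>\<^sup>+u. (\<integral>\<^sup>+v. ennreal (exp (- two_balls_volume u v)) * indicator (cball (0 :: real ^ 'd) (norm u)) v \<partial>lborel) \<partial>lborel) =
    (\<integral>\<^sup>+w. ennreal (1 / (unit_ball_vol DIM(real ^ 'd) * (ball_ratio w)\<^sup>2)) * indicator (cball (0 :: real ^ 'd) 1) w \<partial>lborel)"
proof -
  let ?D = "DIM(real ^ 'd)"
  let ?V = "unit_ball_vol (real ?D)"
  have V: "?V \<noteq> 0" by (metis less_irrefl of_nat_0_le_iff unit_ball_vol_pos)
  have "(\<integral>\<^sup>+u. (\<integral>\<^sup>+v. ennreal (exp (- two_balls_volume u v)) * indicator (cball (0 :: real ^ 'd) (norm u)) v \<partial>lborel) \<partial>lborel) =
   (\<integral>\<^sup>+u. (\<integral>\<^sup>+w. ennreal (norm u ^ ?D * exp (- (norm u ^ ?D * two_balls_volume one_vec w))) *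
       indicator (cball (0 :: real ^ 'd) 1) w \<partial>lborel) \<partial>(lborel :: (real ^ 'd) measure))"
    using AE_lborel_singleton[of "0 :: real ^ 'd"]
    by (intro nn_integral_cong_AE) (auto elim!: eventually_mono simp: nn_integral_exp_two_balls_inner)
  also have "\<dots> = (\<integral>\<^sup>+w. (\<integral>\<^sup>+u. ennreal (norm u ^ ?D * exp (- (norm u ^ ?D * two_balls_volume one_vec w))) *
       indicator (cball (0 :: real ^ 'd) 1) w \<partial>(lborel :: (real ^ 'd) measure)) \<partial>lborel)"
  proof (rule lborel_pair.Fubini')
    have "(\<lambda>p. ennreal (norm (snd p) ^ ?D * exp (- (norm (snd p) ^ ?D * two_balls_volume one_vec (fst p)))) *
         indicator (cball (0 :: real ^ 'd) 1) (fst p)) \<in> borel_measurable (lborel \<Otimes>\<^sub>M (lborel :: (real ^ 'd) measure))"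
      by (intro borel_measurable_times_ennreal measurable_compose[OF measurable_fst borel_measurable_indicator]) auto
    then show "(\<lambda>(w, u). ennreal (norm u ^ ?D * exp (- (norm u ^ ?D * two_balls_volume one_vec w))) *
         indicator (cball (0 :: real ^ 'd) 1) w) \<in> borel_measurable (lborel \<Otimes>\<^sub>M (lborel :: (real ^ 'd) measure))"
      by (simp add: case_prod_beta')
  qed
  also have "\<dots> = (\<integral>\<^sup>+w. ennreal (1 / (?V * (ball_ratio w)\<^sup>2)) * indicator (cball (0 :: real ^ 'd) 1) w \<partial>lborel)"
  proof (intro nn_integral_cong)
    fix w :: "real ^ 'd"
    have "(\<integral>\<^sup>+u. ennreal (norm u ^ ?D * exp (- (norm u ^ ?D * two_balls_volume one_vec w))) \<partial>(lborel :: (real ^ 'd) measure))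
      = (\<integral>\<^sup>+u. ennreal (norm u ^ ?D * exp (- (?V * norm u ^ ?D * ball_ratio w))) \<partial>(lborel :: (real ^ 'd) measure))"
      using V by (simp add: ball_ratio_eq mult_ac)
    also have "\<dots> = ennreal (1 / (?V * (ball_ratio w)\<^sup>2))"
      using ball_ratio_ge_1[of w] by (intro nn_integral_norm_power_exp) auto
    finally show "(\<integral>\<^sup>+u. ennreal (norm u ^ ?D * exp (- (norm u ^ ?D * two_balls_volume one_vec w))) *
       indicator (cball (0 :: real ^ 'd) 1) w \<partial>(lborel :: (real ^ 'd) measure)) =
       ennreal (1 / (?V * (ball_ratio w)\<^sup>2)) * indicator (cball (0 :: real ^ 'd) 1) w"
      by (subst nn_integral_multc) auto
  qed
  finally show ?thesis .
qed

lemma measurable_norm_le_pair: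
  fixes L defines "L \<equiv> lborel :: 'a::euclidean_space measure"
  shows "(\<lambda>p. indicator (cball 0 (norm (fst p))) (snd p) :: ennreal) \<in> borel_measurable (L \<Otimes>\<^sub>M L)"
    and "(\<lambda>p. indicator (cball 0 (norm (snd p))) (fst p) :: ennreal) \<in> borel_measurable (L \<Otimes>\<^sub>M L)"
proof -
  have "closed {p :: 'a \<times> 'a. norm (snd p) \<le> norm (fst p)}" "closed {p :: 'a \<times> 'a. norm (fst p) \<le> norm (snd p)}"
    by (intro closed_Collect_le continuous_intros)+
  then have m: "(indicator {p. norm (snd p) \<le> norm (fst p)} :: _ \<Rightarrow> ennreal) \<in> borel_measurable (L \<Otimes>\<^sub>M L)"
    "(indicator {p. norm (fst p) \<le> norm (snd p)} :: _ \<Rightarrow> ennreal) \<in> borel_measurable (L \<Otimes>\<^sub>M L)"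
    unfolding L_def lborel_prod by (auto intro!: borel_measurable_indicator)
  have e: "indicator {p. norm (snd p) \<le> norm (fst p)} = (\<lambda>p. indicator (cball 0 (norm (fst p))) (snd p :: 'a) :: ennreal)"
    "indicator {p. norm (fst p) \<le> norm (snd p)} = (\<lambda>p. indicator (cball 0 (norm (snd p))) (fst p :: 'a) :: ennreal)"
    by (auto simp: indicator_def)
  show "(\<lambda>p. indicator (cball 0 (norm (fst p))) (snd p) :: ennreal) \<in> borel_measurable (L \<Otimes>\<^sub>M L)"
    using m(1) unfolding e(1) .
  show "(\<lambda>p. indicator (cball 0 (norm (snd p))) (fst p) :: ennreal) \<in> borel_measurable (L \<Otimes>\<^sub>M L)"
    using m(2) unfolding e(2) .
qed

text \<open>The integrand is symmetric, so the halves \<open>norm v \<le> norm u\<close> and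
  \<open>norm u \<le> norm v\<close> contribute \<open>H\<close> each; this produces the numerator 2
  in \<open>alpha\<close>.\<close>

lemma integral_exp_two_balls:
  "(\<integral>p. exp (- two_balls_volume (fst p) (snd p)) \<partial>(lborel :: ((real ^ 'd) \<times> (real ^ 'd)) measure)) = alpha TYPE('d)"
proof -
  let ?L = "lborel :: (real ^ 'd) measure"
  let ?V = "unit_ball_vol (real DIM(real ^ 'd))"
  let ?e = "\<lambda>u v :: real ^ 'd. ennreal (exp (- two_balls_volume u v))"
  define H where "H = (\<integral>\<^sup>+u. (\<integral>\<^sup>+v. ?e u v * indicator (cball 0 (norm u)) v \<partial>?L) \<partial>?L)"
  note ind1 = measurable_norm_le_pair(1)[where 'a="real ^ 'd"] and ind2 = measurable_norm_le_pair(2)[where 'a="real ^ 'd"]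
  have em: "(\<lambda>p. ?e (fst p) (snd p)) \<in> borel_measurable (?L \<Otimes>\<^sub>M ?L)"
    by measurable
  have sym: "(\<integral>\<^sup>+u. (\<integral>\<^sup>+v. ?e u v * indicator (cball 0 (norm v)) u \<partial>?L) \<partial>?L) = H"
  proof -
    have "(\<integral>\<^sup>+u. (\<integral>\<^sup>+v. ?e u v * indicator (cball 0 (norm v)) u \<partial>?L) \<partial>?L) =
      (\<integral>\<^sup>+v. (\<integral>\<^sup>+u. ?e u v * indicator (cball 0 (norm v)) u \<partial>?L) \<partial>?L)"
      by (rule lborel_pair.Fubini'[symmetric])
        (use borel_measurable_times_ennreal[OF em ind2] in \<open>simp add: case_prod_beta'\<close>)
    then show ?thesis by (simp add: H_def two_balls_volume_commute)
  qed
  have "(\<integral>\<^sup>+p. ennreal (exp (- two_balls_volume (fst p) (snd p))) \<partial>(lborel :: ((real ^ 'd) \<times> (real ^ 'd)) measure))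
    = (\<integral>\<^sup>+u. (\<integral>\<^sup>+v. ?e u v \<partial>?L) \<partial>?L)"
    using lborel.nn_integral_fst[OF em] unfolding lborel_prod by simp
  \<comment> \<open>Pairs of equal norm are counted twice on the right; for fixed u they form a null
    sphere.\<close>
  also have "\<dots> = (\<integral>\<^sup>+u. (\<integral>\<^sup>+v. ?e u v * indicator (cball 0 (norm u)) v + ?e u v * indicator (cball 0 (norm v)) u \<partial>?L) \<partial>?L)"
  proof (rule nn_integral_cong, rule nn_integral_cong_AE)
    fix u :: "real ^ 'd"
    have "sphere (0 :: real ^ 'd) (norm u) \<in> null_sets lborel"
      using negligible_sphere[of "0 :: real ^ 'd" "norm u"]
      by (simp add: negligible_iff_null_sets null_sets_completion_iff)
    then have "AE v in ?L. v \<notin> sphere 0 (norm u)" by (rule AE_not_in)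
    then show "AE v in ?L. ?e u v = ?e u v * indicator (cball 0 (norm u)) v + ?e u v * indicator (cball 0 (norm v)) u"
      by eventually_elim (auto simp: indicator_def)
  qed
  also have "\<dots> = (\<integral>\<^sup>+u. (\<integral>\<^sup>+v. ?e u v * indicator (cball 0 (norm u)) v \<partial>?L) + (\<integral>\<^sup>+v. ?e u v * indicator (cball 0 (norm v)) u \<partial>?L) \<partial>?L)"
  proof (intro nn_integral_cong nn_integral_add)
    fix u :: "real ^ 'd"
    show "(\<lambda>v. ?e u v * indicator (cball 0 (norm u)) v) \<in> borel_measurable ?L"
      using measurable_Pair2[OF borel_measurable_times_ennreal[OF em ind1], of u] by simp
    show "(\<lambda>v. ?e u v * indicator (cball 0 (norm v)) u) \<in> borel_measurable ?L"
      using measurable_Pair2[OF borel_measurable_times_ennreal[OF em ind2], of u] by simp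
  qed
  also have "\<dots> = H + (\<integral>\<^sup>+u. (\<integral>\<^sup>+v. ?e u v * indicator (cball 0 (norm v)) u \<partial>?L) \<partial>?L)"
    unfolding H_def
  proof (rule nn_integral_add)
    show "(\<lambda>u. \<integral>\<^sup>+v. ?e u v * indicator (cball 0 (norm u)) v \<partial>?L) \<in> borel_measurable ?L"
      using lborel.borel_measurable_nn_integral_fst[OF borel_measurable_times_ennreal[OF em ind1]]
      by (simp only: fst_conv snd_conv)
    show "(\<lambda>u. \<integral>\<^sup>+v. ?e u v * indicator (cball 0 (norm v)) u \<partial>?L) \<in> borel_measurable ?L"
      using lborel.borel_measurable_nn_integral_fst[OF borel_measurable_times_ennreal[OF em ind2]]
      by (simp only: fst_conv snd_conv)
  qed
  also have "\<dots> = 2 * H" unfolding sym by (simp add: mult_2)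
  also have "\<dots> = (\<integral>\<^sup>+w. 2 * (ennreal (1 / (?V * (ball_ratio w)\<^sup>2)) * indicator (cball (0 :: real ^ 'd) 1) w) \<partial>lborel)"
    unfolding H_def nn_integral_exp_two_balls_half
    by (rule nn_integral_cmult[symmetric])
      (intro borel_measurable_times_ennreal borel_measurable_indicator; simp)
  also have "\<dots> = (\<integral>\<^sup>+w. ennreal (2 / (?V * (ball_ratio w)\<^sup>2)) * indicator (cball (0 :: real ^ 'd) 1) w \<partial>lborel)"
  proof (intro nn_integral_cong)
    fix w :: "real ^ 'd"
    have "2 * ennreal a = ennreal (2 * a)" if "0 \<le> a" for a
      using that by (simp add: ennreal_mult)
    from this[of "1 / (?V * (ball_ratio w)\<^sup>2)"] show "2 * (ennreal (1 / (?V * (ball_ratio w)\<^sup>2)) * indicator (cball (0 :: real ^ 'd) 1) w) =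
      ennreal (2 / (?V * (ball_ratio w)\<^sup>2)) * indicator (cball (0 :: real ^ 'd) 1) w"
      by (simp add: mult.assoc[symmetric])
  qed
  finally have "(\<integral>\<^sup>+p. ennreal (exp (- two_balls_volume (fst p) (snd p))) \<partial>(lborel :: ((real ^ 'd) \<times> (real ^ 'd)) measure))
    = (\<integral>\<^sup>+w. ennreal (2 / (?V * (ball_ratio w)\<^sup>2)) * indicator (cball (0 :: real ^ 'd) 1) w \<partial>lborel)" .
  then show ?thesis
    unfolding alpha_eq_nn_integral by (subst integral_eq_nn_integral) auto
qed

section \<open>Moments of the cell measure as integrals\<close>

text \<open>Fubini moves the expectation inside the \<nu>-integral; for fixed b the event is an
  intersection of independent events of equal probability. Taking \<nu> = \<mu> serves the first
  moment and \<nu> = \<mu> \<Otimes> \<mu> the second.\<close>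

lemma (in prob_space) expectation_measure_all:
  fixes X :: "nat \<Rightarrow> 'a \<Rightarrow> 'b::euclidean_space"
  assumes indep: "indep_vars (\<lambda>_. borel) X I"
    and distr: "\<And>i. i \<in> I \<Longrightarrow> distr M borel (X i) = \<mu>"
    and J: "finite J" "J \<subseteq> I"
    and nu: "finite_measure \<nu>"
    and A: "{p \<in> space (\<nu> \<Otimes>\<^sub>M borel). snd p \<in> A (fst p)} \<in> sets (\<nu> \<Otimes>\<^sub>M borel)"
  shows "(\<integral>\<omega>. measure \<nu> {b \<in> space \<nu>. \<forall>j\<in>J. X j \<omega> \<in> A b} \<partial>M)
    = (\<integral>b. measure \<mu> (A b) ^ card J \<partial>\<nu>)"
proof -
  interpret nu: finite_measure \<nu> by fact
  interpret P: pair_sigma_finite \<nu> M ..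
  interpret PF: finite_measure "\<nu> \<Otimes>\<^sub>M M"
    by (intro finite_measure_pair_measure nu finite_measure_axioms)
  have X[measurable]: "X j \<in> borel_measurable M" if "j \<in> J" for j
    using indep J that by (auto simp: indep_vars_def)
  define B where "B = {p \<in> space (\<nu> \<Otimes>\<^sub>M M). \<forall>j\<in>J. X j (snd p) \<in> A (fst p)}"
  have A_pred[measurable]: "Measurable.pred (\<nu> \<Otimes>\<^sub>M borel) (\<lambda>p. snd p \<in> A (fst p))"
    using A by (simp add: pred_def)
  have BP: "Measurable.pred (\<nu> \<Otimes>\<^sub>M M) (\<lambda>p. \<forall>j\<in>J. X j (snd p) \<in> A (fst p))"
  proof (intro pred_intros_finite J)
    fix j assume j: "j \<in> J"
    have "(\<lambda>p. (fst p, X j (snd p))) \<in> \<nu> \<Otimes>\<^sub>M M \<rightarrow>\<^sub>M \<nu> \<Otimes>\<^sub>M borel"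
      using X[OF j] by measurable
    from measurable_compose[OF this A_pred]
    show "Measurable.pred (\<nu> \<Otimes>\<^sub>M M) (\<lambda>p. X j (snd p) \<in> A (fst p))" by simp
  qed
  have B: "B \<in> sets (\<nu> \<Otimes>\<^sub>M M)" unfolding B_def using BP by (simp add: pred_def)
  have Ab: "A b \<in> sets borel" if "b \<in> space \<nu>" for b
  proof -
    have "Pair b -` {p \<in> space (\<nu> \<Otimes>\<^sub>M borel). snd p \<in> A (fst p)} \<in> sets borel"
      using A by (rule sets_Pair1)
    also have "Pair b -` {p \<in> space (\<nu> \<Otimes>\<^sub>M borel). snd p \<in> A (fst p)} = A b"
      using that by (auto simp: space_pair_measure)
    finally show ?thesis .
  qed
  have int: "integrable (\<nu> \<Otimes>\<^sub>M M) (\<lambda>(b, \<omega>). indicator B (b, \<omega>) :: real)"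
    using B by (simp add: PF.emeasure_finite less_top[symmetric])
  have "(\<integral>\<omega>. measure \<nu> {b \<in> space \<nu>. \<forall>j\<in>J. X j \<omega> \<in> A b} \<partial>M)
    = (\<integral>\<omega>. (\<integral>b. indicator B (b, \<omega>) \<partial>\<nu>) \<partial>M)"
  proof (intro Bochner_Integration.integral_cong refl)
    fix \<omega> assume w: "\<omega> \<in> space M"
    have "(\<lambda>b. (b, \<omega>)) -` B = {b \<in> space \<nu>. \<forall>j\<in>J. X j \<omega> \<in> A b}"
      using w by (auto simp: B_def space_pair_measure)
    moreover have "(\<lambda>b. (b, \<omega>)) -` B \<in> sets \<nu>" using B by (rule sets_Pair2)
    ultimately have "measure \<nu> {b \<in> space \<nu>. \<forall>j\<in>J. X j \<omega> \<in> A b} = (\<integral>b. indicator {b \<in> space \<nu>. \<forall>j\<in>J. X j \<omega> \<in> A b} b \<partial>\<nu>)"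
      by simp
    also have "\<dots> = (\<integral>b. indicator B (b, \<omega>) \<partial>\<nu>)"
      using w by (intro Bochner_Integration.integral_cong refl) (auto simp: B_def space_pair_measure indicator_def)
    finally show "measure \<nu> {b \<in> space \<nu>. \<forall>j\<in>J. X j \<omega> \<in> A b} = (\<integral>b. indicator B (b, \<omega>) \<partial>\<nu>)" .
  qed
  also have "\<dots> = (\<integral>b. (\<integral>\<omega>. indicator B (b, \<omega>) \<partial>M) \<partial>\<nu>)"
    by (rule P.Fubini_integral[OF int])
  also have "\<dots> = (\<integral>b. measure \<mu> (A b) ^ card J \<partial>\<nu>)"
  proof (intro Bochner_Integration.integral_cong refl)
    fix b assume b: "b \<in> space \<nu>"
    have "(\<integral>\<omega>. indicator B (b, \<omega>) \<partial>M) = (\<integral>\<omega>. indicator {\<omega> \<in> space M. \<forall>j\<in>J. X j \<omega> \<in> A b} \<omega> \<partial>M :: real)"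
      using b by (intro Bochner_Integration.integral_cong refl) (auto simp: B_def space_pair_measure indicator_def)
    also have "\<dots> = prob {\<omega> \<in> space M. \<forall>j\<in>J. X j \<omega> \<in> A b}"
      using Ab[OF b] J X by simp
    also have "\<dots> = measure \<mu> (A b) ^ card J"
    \<comment> \<open>Independence speaks of non-empty index sets only. J is empty when n \<le> 1,
      and then both sides are 1.\<close>
    proof (cases "J = {}")
      case False
      have "{\<omega> \<in> space M. \<forall>j\<in>J. X j \<omega> \<in> A b} = (\<Inter>j\<in>J. X j -` A b \<inter> space M)"
        using False by auto
      also have "prob \<dots> = (\<Prod>j\<in>J. prob (X j -` A b \<inter> space M))"
        using Ab[OF b] False J by (intro indep_varsD[OF indep]) auto
      also have "\<dots> = (\<Prod>j\<in>J. measure \<mu> (A b))"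
      proof (intro prod.cong refl)
        fix j assume j: "j \<in> J"
        have "measure \<mu> (A b) = measure (distr M borel (X j)) (A b)" using distr j J by auto
        also have "\<dots> = prob (X j -` A b \<inter> space M)"
          using X[OF j] Ab[OF b] by (rule measure_distr)
        finally show "prob (X j -` A b \<inter> space M) = measure \<mu> (A b)" ..
      qed
      finally show ?thesis by simp
    qed (simp add: prob_space)
    finally show "(\<integral>\<omega>. indicator B (b, \<omega>) \<partial>M) = measure \<mu> (A b) ^ card J" .
  qed
  finally show ?thesis .
qed

text \<open>Index 1 wins every tie, so a competitor removes y only by being strictly closer than x.
  Hence the balls are open and tie-breaking disappears from here on.\<close>

lemma voronoi_cell_first:
  "voronoi_cell ((\<lambda>j. X j \<omega>)(1 := x)) n 1 =
    {y. \<forall>j\<in>{2..n}. X j \<omega> \<notin> ball y (dist y x)}"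
proof -
  have "{1..n} \<subseteq> insert 1 {2..n}" by auto
  then show ?thesis
    unfolding voronoi_cell_def by (auto simp: dist_norm not_less)
qed


locale sample_with_density = prob_space M
  for M :: "'w measure" +
  fixes \<mu> :: "(real ^ 'd) measure" and f :: "real ^ 'd \<Rightarrow> real" and X :: "nat \<Rightarrow> 'w \<Rightarrow> real ^ 'd"
  assumes prob_space_mu: "prob_space \<mu>"
    and borel_measurable_f: "f \<in> borel_measurable lborel"
    and f_nonneg: "0 \<le> f x"
    and mu_density: "\<mu> = density lborel (\<lambda>x. ennreal (f x))"
    and indep_X: "indep_vars (\<lambda>_. borel) X {1..}"
    and distr_X: "i \<ge> 1 \<Longrightarrow> distr M borel (X i) = \<mu>"
begin

sublocale mu: prob_space \<mu> by (rule prob_space_mu)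

lemma f_measurable[measurable]: "f \<in> borel_measurable borel"
  using borel_measurable_f by simp

lemma sets_mu[measurable_cong, simp]: "sets \<mu> = sets borel"
  by (simp add: mu_density)

lemma space_mu[simp]: "space \<mu> = UNIV"
  by (simp add: mu_density)

lemma integral_mu_pair:
  assumes [measurable]: "g \<in> borel_measurable borel"
  shows "(\<integral>p. g p \<partial>(\<mu> \<Otimes>\<^sub>M \<mu>)) = (\<integral>p. f (fst p) * f (snd p) * g p \<partial>lborel)"
proof -
  have "\<mu> \<Otimes>\<^sub>M \<mu> = density (lborel \<Otimes>\<^sub>M lborel) (\<lambda>(x, y). ennreal (f x) * ennreal (f y))"
    unfolding mu_density
    by (rule pair_measure_density)
      (auto intro: sigma_finite_lborel mu.sigma_finite_measure_axioms[unfolded mu_density])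
  also have "\<dots> = density lborel (\<lambda>p. ennreal (f (fst p) * f (snd p)))"
    unfolding lborel_prod by (simp add: case_prod_beta' ennreal_mult f_nonneg)
  finally have pair_eq: "\<mu> \<Otimes>\<^sub>M \<mu> = density lborel (\<lambda>p. ennreal (f (fst p) * f (snd p)))" .
  then show ?thesis
    using f_nonneg by (subst pair_eq, subst integral_density)
      (auto simp: measurable_lborel1 intro!: borel_measurable_times)
qed

lemma measure_UN_balls_measurable[measurable]:
  assumes "g \<in> borel_measurable N" "h \<in> borel_measurable N"
  shows "(\<lambda>w. measure \<mu> (ball (g w) (dist (g w) x) \<union> ball (h w) (dist (h w) x))) \<in> borel_measurable N"
  by (intro borel_measurable_measure_two_balls assms mu.sigma_finite_measure_axioms) simp

lemma measure_ball_measurable[measurable]: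
  assumes [measurable]: "g \<in> borel_measurable N"
  shows "(\<lambda>w. measure \<mu> (ball (g w) (dist (g w) x))) \<in> borel_measurable N"
  using measure_UN_balls_measurable[OF assms assms] by simp

lemma expectation_measure_voronoi_cell:
  "(\<integral>\<omega>. measure \<mu> (voronoi_cell ((\<lambda>j. X j \<omega>)(1 := x)) n 1) \<partial>M)
    = (\<integral>y. f y * (1 - measure \<mu> (ball y (dist y x))) ^ (n - 1) \<partial>lborel)"
proof -
  have m: "{p \<in> space (\<mu> \<Otimes>\<^sub>M borel). snd p \<in> - ball (fst p) (dist (fst p) x)} \<in> sets (\<mu> \<Otimes>\<^sub>M borel)"
    unfolding Compl_iff mem_ball by measurable
  have "(\<integral>\<omega>. measure \<mu> (voronoi_cell ((\<lambda>j. X j \<omega>)(1 := x)) n 1) \<partial>M) =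
    (\<integral>\<omega>. measure \<mu> {y \<in> space \<mu>. \<forall>j\<in>{2..n}. X j \<omega> \<in> - ball y (dist y x)} \<partial>M)"
    unfolding voronoi_cell_first by simp
  also have "\<dots> = (\<integral>y. measure \<mu> (- ball y (dist y x)) ^ card {2..n} \<partial>\<mu>)"
    using distr_X mu.finite_measure_axioms m
    by (intro expectation_measure_all[OF indep_X]) auto
  \<comment> \<open>\<open>card {2..n} = n - 1\<close> also at n = 0, by truncated
    subtraction.\<close>
  also have "\<dots> = (\<integral>y. (1 - measure \<mu> (ball y (dist y x))) ^ (n - 1) \<partial>\<mu>)"
    using mu.prob_compl by (simp add: Compl_eq_Diff_UNIV)
  also have "\<dots> = (\<integral>y. f y * (1 - measure \<mu> (ball y (dist y x))) ^ (n - 1) \<partial>lborel)"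
    by (subst mu_density, subst integral_density) (auto simp: f_nonneg)
  finally show ?thesis .
qed

text \<open>The square of the cell measure is the product measure of cell times cell, and two points
  both lie in the cell exactly when every other sample point avoids both of their balls.\<close>

lemma expectation_measure_voronoi_cell_square:
  "(\<integral>\<omega>. (measure \<mu> (voronoi_cell ((\<lambda>j. X j \<omega>)(1 := x)) n 1))\<^sup>2 \<partial>M)
    = (\<integral>p. f (fst p) * f (snd p) *
        (1 - measure \<mu> (ball (fst p) (dist (fst p) x) \<union> ball (snd p) (dist (snd p) x))) ^ (n - 1) \<partial>lborel)"
proof -
  define A where "A p = - (ball (fst p) (dist (fst p) x) \<union> ball (snd p) (dist (snd p) x))" for p
  have m: "{p \<in> space ((\<mu> \<Otimes>\<^sub>M \<mu>) \<Otimes>\<^sub>M borel). snd p \<in> A (fst p)} \<in> sets ((\<mu> \<Otimes>\<^sub>M \<mu>) \<Otimes>\<^sub>M borel)"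
    unfolding A_def Compl_iff Un_iff mem_ball by measurable
  have "(\<integral>\<omega>. (measure \<mu> (voronoi_cell ((\<lambda>j. X j \<omega>)(1 := x)) n 1))\<^sup>2 \<partial>M) =
    (\<integral>\<omega>. measure (\<mu> \<Otimes>\<^sub>M \<mu>) {p \<in> space (\<mu> \<Otimes>\<^sub>M \<mu>). \<forall>j\<in>{2..n}. X j \<omega> \<in> A p} \<partial>M)"
  proof (intro Bochner_Integration.integral_cong refl)
    fix \<omega> assume "\<omega> \<in> space M"
    let ?V = "voronoi_cell ((\<lambda>j. X j \<omega>)(1 := x)) n 1"
    have "?V \<in> sets borel"
    proof -
      have "closed ?V"
        unfolding voronoi_cell_first Ball_def mem_ball not_less
        by (intro closed_Collect_all closed_Collect_imp open_Collect_const closed_Collect_le continuous_intros)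
      then show ?thesis by (rule borel_closed)
    qed
    then have "measure (\<mu> \<Otimes>\<^sub>M \<mu>) (?V \<times> ?V) = (measure \<mu> ?V)\<^sup>2"
      by (simp add: measure_def mu.emeasure_pair_measure_Times enn2real_mult power2_eq_square)
    moreover have "{p \<in> space (\<mu> \<Otimes>\<^sub>M \<mu>). \<forall>j\<in>{2..n}. X j \<omega> \<in> A p} = ?V \<times> ?V"
      unfolding voronoi_cell_first by (auto simp: A_def space_pair_measure)
    ultimately show "(measure \<mu> ?V)\<^sup>2 = measure (\<mu> \<Otimes>\<^sub>M \<mu>) {p \<in> space (\<mu> \<Otimes>\<^sub>M \<mu>). \<forall>j\<in>{2..n}. X j \<omega> \<in> A p}"
      by simp
  qed
  also have "\<dots> = (\<integral>p. measure \<mu> (A p) ^ card {2..n} \<partial>(\<mu> \<Otimes>\<^sub>M \<mu>))"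
    using distr_X m
    by (intro expectation_measure_all[OF indep_X]) (auto intro!: finite_measure_pair_measure mu.finite_measure_axioms)
  also have "\<dots> = (\<integral>p. (1 - measure \<mu> (- A p)) ^ (n - 1) \<partial>(\<mu> \<Otimes>\<^sub>M \<mu>))"
    using mu.prob_compl unfolding A_def by (simp add: Compl_eq_Diff_UNIV)
  also have "\<dots> = (\<integral>p. f (fst p) * f (snd p) * (1 - measure \<mu> (- A p)) ^ (n - 1) \<partial>lborel)"
  proof (rule integral_mu_pair)
    show "(\<lambda>p. (1 - measure \<mu> (- A p)) ^ (n - 1)) \<in> borel_measurable borel"
      unfolding A_def double_compl by measurable
  qed
  finally show ?thesis by (simp add: A_def)
qed

end

section \<open>Scaling at a Lebesgue point\<close>

text \<open>The scaling argument is deterministic, so no sample occurs here. \<open>f_pos\<close>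
  fixes the scale; it holds \<mu>-almost everywhere, though not in general Lebesgue-almost
  everywhere.\<close>

locale lebesgue_point_density = prob_space \<mu>
  for \<mu> :: "'a::euclidean_space measure" +
  fixes f :: "'a \<Rightarrow> real" and x :: 'a
  assumes f_measurable[measurable]: "f \<in> borel_measurable borel"
    and f_nonneg: "0 \<le> f y"
    and mu_density: "\<mu> = density lborel (\<lambda>y. ennreal (f y))"
    and f_pos: "0 < f x"
    and lebesgue_point: "0 < e \<Longrightarrow> \<exists>d>0. \<forall>r. 0 < r \<longrightarrow> r < d \<longrightarrow>
      (\<integral>\<^sup>+y\<in>ball x r. ennreal \<bar>f y - f x\<bar> \<partial>lborel) \<le> ennreal e * emeasure lborel (ball x r)"
begin

lemma V_pos: "0 < unit_ball_vol DIM('a)" and V_neq_0: "unit_ball_vol DIM('a) \<noteq> 0"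
  by (simp, metis less_irrefl of_nat_0_le_iff unit_ball_vol_pos)

lemma sets_mu[measurable_cong, simp]: "sets \<mu> = sets borel"
  by (simp add: mu_density)

lemma nn_integral_f: "(\<integral>\<^sup>+y. ennreal (f y) \<partial>lborel) = 1"
  using emeasure_space_1 by (simp add: mu_density emeasure_density)

lemma integrable_f: "integrable lborel f"
  using nn_integral_f f_nonneg by (intro integrableI_nonneg) auto

lemma integral_f: "(\<integral>y. f y \<partial>lborel) = 1"
  using nn_integral_f f_nonneg by (subst integral_eq_nn_integral) auto

lemma deviation_small:
  assumes e: "0 < e"
  obtains d where "0 < d" "\<And>r. 0 < r \<Longrightarrow> r < d \<Longrightarrow>
    (\<integral>\<^sup>+y\<in>ball x r. ennreal \<bar>f y - f x\<bar> \<partial>lborel) \<le> ennreal (e * r ^ DIM('a))"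
proof -
  obtain d where d: "0 < d" "\<And>r. 0 < r \<Longrightarrow> r < d \<Longrightarrow>
      (\<integral>\<^sup>+y\<in>ball x r. ennreal \<bar>f y - f x\<bar> \<partial>lborel) \<le> ennreal (e / unit_ball_vol DIM('a)) * emeasure lborel (ball x r)"
    using lebesgue_point[of "e / unit_ball_vol DIM('a)"] e V_pos by (meson divide_pos_pos)
  have "ennreal (e / unit_ball_vol DIM('a)) * emeasure lborel (ball x r) = ennreal (e * r ^ DIM('a))" if "0 < r" for r
  proof -
    have "e / unit_ball_vol DIM('a) * (unit_ball_vol DIM('a) * r ^ DIM('a)) = e * r ^ DIM('a)" using V_neq_0 by simp
    then show ?thesis using that e V_pos
      by (simp only: emeasure_ball[OF less_imp_le[OF that]])
        (subst ennreal_mult[symmetric]; simp add: V_neq_0)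
  qed
  with d show ?thesis by (intro that[of d]) auto
qed

text \<open>Small radii follow from the Lebesgue property. For r \<ge> d the deviation is at most
  the total mass 1 of f plus f x times the ball volume; the term \<open>1 / d ^ DIM('a)\<close> in
  \<open>C\<close> pays for that mass, because r / d \<ge> 1.\<close>

lemma deviation_bound:
  obtains C where "0 \<le> C" "\<And>r. 0 < r \<Longrightarrow>
    (\<integral>\<^sup>+y\<in>ball x r. ennreal \<bar>f y - f x\<bar> \<partial>lborel) \<le> ennreal (C * r ^ DIM('a))"
proof -
  obtain d where d: "0 < d" "\<And>r. 0 < r \<Longrightarrow> r < d \<Longrightarrow>
    (\<integral>\<^sup>+y\<in>ball x r. ennreal \<bar>f y - f x\<bar> \<partial>lborel) \<le> ennreal (1 * r ^ DIM('a))"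
    by (rule deviation_small[of 1]) auto
  define C where "C = 1 + 1 / d ^ DIM('a) + f x * unit_ball_vol DIM('a)"
  have C: "0 \<le> C" "1 \<le> C"
    using d f_nonneg[of x] V_pos by (auto simp: C_def)
  have "(\<integral>\<^sup>+y\<in>ball x r. ennreal \<bar>f y - f x\<bar> \<partial>lborel) \<le> ennreal (C * r ^ DIM('a))" if r: "0 < r" for r
  proof (cases "r < d")
    case True
    have "1 * r ^ DIM('a) \<le> C * r ^ DIM('a)" using C r by (intro mult_right_mono) auto
    then show ?thesis using d(2)[OF r True] by (meson ennreal_leI order_trans)
  next
    case False
    have "(\<integral>\<^sup>+y\<in>ball x r. ennreal \<bar>f y - f x\<bar> \<partial>lborel) \<le>
      (\<integral>\<^sup>+y. ennreal (f y) + ennreal (f x) * indicator (ball x r) y \<partial>lborel)"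
    proof (intro nn_integral_mono)
      fix y
      have "ennreal \<bar>f y - f x\<bar> \<le> ennreal (f y + f x)"
        using f_nonneg[of x] f_nonneg[of y] by (intro ennreal_leI) auto
      then show "ennreal \<bar>f y - f x\<bar> * indicator (ball x r) y \<le> ennreal (f y) + ennreal (f x) * indicator (ball x r) y"
        using f_nonneg[of x] f_nonneg[of y] by (cases "y \<in> ball x r") auto
    qed
    also have "\<dots> = 1 + ennreal (f x) * emeasure lborel (ball x r)"
      by (subst nn_integral_add)
        (auto simp: nn_integral_f nn_integral_cmult_indicator intro!: borel_measurable_times_ennreal borel_measurable_indicator)
    also have "\<dots> = ennreal (1 + f x * (unit_ball_vol DIM('a) * r ^ DIM('a)))"
      using r f_nonneg[of x] V_pos by (simp add: emeasure_ball ennreal_mult)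
    also have "\<dots> \<le> ennreal (C * r ^ DIM('a))"
    proof (rule ennreal_leI)
      have "d ^ DIM('a) \<le> r ^ DIM('a)" using False d by (intro power_mono) auto
      then have "1 \<le> 1 / d ^ DIM('a) * r ^ DIM('a)" using d by (simp add: field_simps)
      moreover have "0 \<le> r ^ DIM('a)" using r by simp
      ultimately show "1 + f x * (unit_ball_vol DIM('a) * r ^ DIM('a)) \<le> C * r ^ DIM('a)"
        by (simp add: C_def algebra_simps)
    qed
    finally show ?thesis .
  qed
  with C show ?thesis by (intro that)
qed

text \<open>The set S may be any Borel part of the centred ball, since |f - f x| is integrated over
  the whole ball. This transfers centred averages to balls that merely touch x.\<close>

lemma measure_deviation:
  assumes S: "S \<in> sets borel" "S \<subseteq> ball x r" and K: "0 \<le> K"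
    "(\<integral>\<^sup>+y\<in>ball x r. ennreal \<bar>f y - f x\<bar> \<partial>lborel) \<le> ennreal K"
  shows "\<bar>prob S - f x * measure lborel S\<bar> \<le> K"
proof -
  have fin: "emeasure lborel S < \<infinity>"
    using S by (intro emeasure_bounded_finite bounded_subset[OF bounded_ball])
  have iS: "integrable lborel (\<lambda>y. f x * indicator S y)"
    using S fin by (intro integrable_mult_right) auto
  have ifS: "integrable lborel (\<lambda>y. f y * indicator S y)"
    using S by (intro integrable_real_mult_indicator integrable_f) auto
  have "prob S = (\<integral>y. f y * indicator S y \<partial>lborel)"
  proof -
    have "prob S = (\<integral>y. indicator S y \<partial>\<mu>)" using S by simp
    also have "\<dots> = (\<integral>y. f y * indicator S y \<partial>lborel)"
      unfolding mu_density using S f_nonneg by (subst integral_density) (auto intro!: borel_measurable_indicator)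
    finally show ?thesis .
  qed
  moreover have "f x * measure lborel S = (\<integral>y. f x * indicator S y \<partial>lborel)"
    using S by simp
  ultimately have "prob S - f x * measure lborel S = (\<integral>y. f y * indicator S y - f x * indicator S y \<partial>lborel)"
    using Bochner_Integration.integral_diff[OF ifS iS] by simp
  then have "ennreal \<bar>prob S - f x * measure lborel S\<bar> \<le> (\<integral>\<^sup>+y. ennreal (norm (f y * indicator S y - f x * indicator S y)) \<partial>lborel)"
    using integral_norm_bound_ennreal[OF Bochner_Integration.integrable_diff[OF ifS iS]] by simp
  also have "\<dots> \<le> (\<integral>\<^sup>+y\<in>ball x r. ennreal \<bar>f y - f x\<bar> \<partial>lborel)"
    using S(2) by (intro nn_integral_mono) (auto simp: indicator_def)
  also note K(2)
  finally show ?thesis using K(1) by simp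
qed

lemma ball_subset_twice:
  "ball y (dist y x) \<subseteq> ball x (2 * dist y x)"
proof
  fix z assume "z \<in> ball y (dist y x)"
  then show "z \<in> ball x (2 * dist y x)"
    using dist_triangle[of x z y] by (simp add: dist_commute)
qed

text \<open>The \<open>max\<close> only keeps the scale positive at \<open>n = 0\<close>.\<close>

definition scale :: "nat \<Rightarrow> real" where
  "scale n = root DIM('a) (1 / (f x * real (max 1 n)))"

lemma scale_pos: "0 < scale n"
  using f_pos by (simp add: scale_def)

lemma scale_power: "0 < n \<Longrightarrow> real n * scale n ^ DIM('a) * f x = 1"
  using f_pos by (simp add: scale_def field_simps max_def)

lemma scale_tendsto_0: "scale \<longlonglongrightarrow> 0"
proof -
  have "(\<lambda>n. 1 / f x * (1 / real n)) \<longlonglongrightarrow> 1 / f x * 0"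
    by (intro tendsto_intros lim_1_over_n)
  moreover have "eventually (\<lambda>n. 1 / f x * (1 / real n) = 1 / (f x * real (max 1 n))) sequentially"
    using eventually_gt_at_top[of 0] by eventually_elim (auto simp: max_def)
  ultimately have "(\<lambda>n. 1 / (f x * real (max 1 n))) \<longlonglongrightarrow> 1 / f x * 0"
    by (rule Lim_transform_eventually)
  then have "(\<lambda>n. 1 / (f x * real (max 1 n))) \<longlonglongrightarrow> 0"
    by (simp only: mult_zero_right)
  from tendsto_real_root[OF this, of "DIM('a)"] show ?thesis
    by (simp add: scale_def[abs_def])
qed

text \<open>The probability that a sample point excludes \<open>y\<close> or \<open>z\<close> from the cell of \<open>x\<close>.\<close>

definition hit :: "'a \<Rightarrow> 'a \<Rightarrow> real" where
  "hit y z = prob (ball y (dist y x) \<union> ball z (dist z x))"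

lemma hit_bounds: "0 \<le> hit y z" "hit y z \<le> 1"
  by (simp_all add: hit_def)

lemma hit_ge: "hit y y \<le> hit y z" "hit z z \<le> hit y z"
  unfolding hit_def by (intro finite_measure_mono; auto)+

lemma borel_measurable_hit[measurable]:
  assumes "g \<in> borel_measurable N" "h \<in> borel_measurable N"
  shows "(\<lambda>w. hit (g w) (h w)) \<in> borel_measurable N"
  unfolding hit_def
  by (intro borel_measurable_measure_two_balls assms sigma_finite_measure_axioms) simp

text \<open>The scaled balls lie in a centred ball of radius proportional to the scale, so their
  measure is f x times their volume up to o(scale^d). Multiplication by n cancels f x *
  scale^d.\<close>

lemma scaled_hit_tendsto:
  "(\<lambda>n. real n * hit (x + scale n *\<^sub>R u) (x + scale n *\<^sub>R v)) \<longlonglongrightarrow> two_balls_volume u v"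
proof (rule LIMSEQ_I)
  fix e :: real assume e: "0 < e"
  \<comment> \<open>By \<open>ball_subset_twice\<close> both scaled balls lie within radius
    \<open>scale n * \<rho>\<close> of x; the summand 1 keeps \<rho> positive when u = v =
    0.\<close>
  define \<rho> where "\<rho> = 2 * (norm u + norm v) + 1"
  have \<rho>: "0 < \<rho>" unfolding \<rho>_def by (simp add: add_nonneg_pos)
  \<comment> \<open>Chosen so that, by \<open>scale_power\<close>, n times the deviation bound at
    radius \<open>scale n * \<rho>\<close> is e / 2.\<close>
  define e' where "e' = e / 2 * f x / \<rho> ^ DIM('a)"
  have e': "0 < e'" using e f_pos \<rho> by (simp add: e'_def)
  obtain d where d: "0 < d" "\<And>r. 0 < r \<Longrightarrow> r < d \<Longrightarrow>
    (\<integral>\<^sup>+y\<in>ball x r. ennreal \<bar>f y - f x\<bar> \<partial>lborel) \<le> ennreal (e' * r ^ DIM('a))"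
    by (rule deviation_small[OF e']) blast
  have "(\<lambda>n. scale n * \<rho>) \<longlonglongrightarrow> 0 * \<rho>" by (intro tendsto_intros scale_tendsto_0)
  then have "eventually (\<lambda>n. scale n * \<rho> < d) sequentially"
    using d(1) by (intro order_tendstoD(2)) auto
  then have "eventually (\<lambda>n. norm (real n * hit (x + scale n *\<^sub>R u) (x + scale n *\<^sub>R v) - two_balls_volume u v) < e) sequentially"
    using eventually_gt_at_top[of 0]
  proof eventually_elim
    case (elim n)
    let ?h = "scale n"
    let ?S = "ball (x + ?h *\<^sub>R u) (?h * norm u) \<union> ball (x + ?h *\<^sub>R v) (?h * norm v)"
    have h: "0 < ?h" by (rule scale_pos)
    have dist: "dist (x + ?h *\<^sub>R w) x = ?h * norm w" for w using h by (simp add: dist_norm)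
    have "ball (x + ?h *\<^sub>R w) (?h * norm w) \<subseteq> ball x (?h * \<rho>)" if "norm w \<le> norm u + norm v" for w
    proof -
      have "ball (x + ?h *\<^sub>R w) (?h * norm w) \<subseteq> ball x (2 * (?h * norm w))"
        using ball_subset_twice[of "x + ?h *\<^sub>R w"] by (simp only: dist)
      also have "2 * (?h * norm w) = ?h * (2 * norm w)" by simp
      also have "ball x (?h * (2 * norm w)) \<subseteq> ball x (?h * \<rho>)"
        using h that by (intro subset_ball mult_left_mono) (auto simp: \<rho>_def)
      finally show ?thesis .
    qed
    then have sub: "?S \<subseteq> ball x (?h * \<rho>)" by simp
    have "\<bar>prob ?S - f x * measure lborel ?S\<bar> \<le> e' * (?h * \<rho>) ^ DIM('a)"
      using elim h \<rho> e' by (intro measure_deviation[OF _ sub] d) auto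
    also have "e' * (?h * \<rho>) ^ DIM('a) = (e / 2) * (?h ^ DIM('a) * f x)"
      using \<rho> by (simp add: e'_def power_mult_distrib)
    also have "measure lborel ?S = ?h ^ DIM('a) * two_balls_volume u v"
      using emeasure_two_balls_affine[OF h, of x u v] h by (simp add: measure_def)
    finally have "real n * \<bar>prob ?S - f x * (?h ^ DIM('a) * two_balls_volume u v)\<bar> \<le> real n * ((e / 2) * (?h ^ DIM('a) * f x))"
      by (rule mult_left_mono) simp
    also have "\<dots> = (e / 2) * (real n * ?h ^ DIM('a) * f x)" by simp
    also have "\<dots> = e / 2" using scale_power[OF elim(2)] by simp
    finally have *: "real n * \<bar>prob ?S - f x * (?h ^ DIM('a) * two_balls_volume u v)\<bar> \<le> e / 2" .
    have "real n * prob ?S - two_balls_volume u v = real n * prob ?S - (real n * ?h ^ DIM('a) * f x) * two_balls_volume u v"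
      using scale_power[OF elim(2)] by simp
    also have "\<dots> = real n * (prob ?S - f x * (?h ^ DIM('a) * two_balls_volume u v))" by (simp add: algebra_simps)
    finally have "norm (real n * prob ?S - two_balls_volume u v) \<le> e / 2"
      using * by (simp add: abs_mult)
    then show ?case using e by (simp add: hit_def dist)
  qed
  then show "\<exists>n0. \<forall>n\<ge>n0. norm (real n * hit (x + scale n *\<^sub>R u) (x + scale n *\<^sub>R v) - two_balls_volume u v) < e"
    by (simp add: eventually_sequentially)
qed

text \<open>Near x the deviation is at most half of the main term. Beyond \<delta> the bound
  persists, because a ball through x contains every smaller ball internally tangent to it at
  x.\<close>

lemma hit_lower_bound:
  obtains \<delta> where "0 < \<delta>" "\<And>y. dist y x \<le> \<delta> \<Longrightarrow> f x / 2 * unit_ball_vol DIM('a) * dist y x ^ DIM('a) \<le> hit y y"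
    "\<And>y. \<delta> < dist y x \<Longrightarrow> f x / 2 * unit_ball_vol DIM('a) * \<delta> ^ DIM('a) \<le> hit y y"
proof -
  \<comment> \<open>The divisor \<open>2 ^ DIM('a)\<close> undoes the doubling of the radius in
    \<open>ball_subset_twice\<close>, so the error is half of f x * V * r^d.\<close>
  define e where "e = f x / 2 * unit_ball_vol DIM('a) / 2 ^ DIM('a)"
  have e: "0 < e" using f_pos V_pos by (simp add: e_def)
  obtain d where d: "0 < d" "\<And>r. 0 < r \<Longrightarrow> r < d \<Longrightarrow>
    (\<integral>\<^sup>+y\<in>ball x r. ennreal \<bar>f y - f x\<bar> \<partial>lborel) \<le> ennreal (e * r ^ DIM('a))"
    by (rule deviation_small[OF e]) blast
  \<comment> \<open>With distance at most d / 3 the doubled radius stays below d.\<close>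
  have near: "f x / 2 * unit_ball_vol DIM('a) * dist y x ^ DIM('a) \<le> hit y y" if "dist y x \<le> d / 3" for y
  proof (cases "y = x")
    case True
    then show ?thesis by (simp add: hit_bounds zero_power)
  next
    case False
    then have p: "0 < dist y x" by simp
    have "\<bar>prob (ball y (dist y x)) - f x * measure lborel (ball y (dist y x))\<bar> \<le> e * (2 * dist y x) ^ DIM('a)"
      using that p e d(1) by (intro measure_deviation[OF _ ball_subset_twice] d(2)) auto
    also have "e * (2 * dist y x) ^ DIM('a) = f x / 2 * unit_ball_vol DIM('a) * dist y x ^ DIM('a)"
      by (simp add: e_def power_mult_distrib)
    also have "measure lborel (ball y (dist y x)) = unit_ball_vol DIM('a) * dist y x ^ DIM('a)"
      using p by (simp add: content_ball)
    finally have *: "\<bar>prob (ball y (dist y x)) - f x * (unit_ball_vol DIM('a) * dist y x ^ DIM('a))\<bar>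
      \<le> f x / 2 * unit_ball_vol DIM('a) * dist y x ^ DIM('a)" .
    have "f x / 2 * unit_ball_vol DIM('a) * dist y x ^ DIM('a) = f x * (unit_ball_vol DIM('a) * dist y x ^ DIM('a)) / 2"
      by simp
    with * show ?thesis unfolding hit_def Un_absorb by linarith
  qed
  have far: "f x / 2 * unit_ball_vol DIM('a) * (d / 3) ^ DIM('a) \<le> hit y y" if y: "d / 3 < dist y x" for y
  proof -
    \<comment> \<open>The point at distance d / 3 from x on the segment towards y; its ball through
      x touches that of y internally at x.\<close>
    define y' where "y' = x + ((d / 3) / dist y x) *\<^sub>R (y - x)"
    have p: "0 < dist y x" using y d by linarith
    have d1: "dist y' x = d / 3" using p d by (simp add: y'_def dist_norm)
    have "y - y' = (1 - (d / 3) / dist y x) *\<^sub>R (y - x)"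
      by (simp add: y'_def algebra_simps)
    then have "dist y y' = \<bar>1 - (d / 3) / dist y x\<bar> * dist y x"
      by (simp add: dist_norm)
    also have "\<dots> = dist y x - d / 3"
      using p y by (simp add: abs_of_nonneg left_diff_distrib)
    finally have d2: "dist y y' = dist y x - d / 3" .
    have "ball y' (dist y' x) \<subseteq> ball y (dist y x)"
    proof
      fix z assume "z \<in> ball y' (dist y' x)"
      then show "z \<in> ball y (dist y x)"
        using d1 d2 dist_triangle[of y z y'] by simp
    qed
    then have "hit y' y' \<le> hit y y" unfolding hit_def by (intro finite_measure_mono) auto
    moreover have "f x / 2 * unit_ball_vol DIM('a) * (d / 3) ^ DIM('a) \<le> hit y' y'" using near[of y'] d1 by simp
    ultimately show ?thesis by linarith
  qed
  show ?thesis using d(1) by (intro that[of "d / 3"] near far) auto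
qed

end

lemma nn_integral_lborel_fst_snd:
  fixes a :: "'a::euclidean_space \<Rightarrow> ennreal" and b :: "'b::euclidean_space \<Rightarrow> ennreal"
  assumes [measurable]: "a \<in> borel_measurable borel" "b \<in> borel_measurable borel"
  shows "(\<integral>\<^sup>+p. a (fst p) * b (snd p) \<partial>lborel) = (\<integral>\<^sup>+u. a u \<partial>lborel) * (\<integral>\<^sup>+v. b v \<partial>lborel)"
proof -
  have "(\<integral>\<^sup>+p. a (fst p) * b (snd p) \<partial>(lborel \<Otimes>\<^sub>M lborel)) = (\<integral>\<^sup>+u. (\<integral>\<^sup>+v. a u * b v \<partial>lborel) \<partial>lborel)"
    by (subst lborel.nn_integral_fst[symmetric]) auto
  also have "\<dots> = (\<integral>\<^sup>+u. a u * (\<integral>\<^sup>+v. b v \<partial>lborel) \<partial>lborel)"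
    by (intro nn_integral_cong nn_integral_cmult) simp
  also have "\<dots> = (\<integral>\<^sup>+u. a u \<partial>lborel) * (\<integral>\<^sup>+v. b v \<partial>lborel)"
    by (rule nn_integral_multc) simp
  finally show ?thesis unfolding lborel_prod .
qed

section \<open>Domination by an exponential weight and the limits of the two moments\<close>

context lebesgue_point_density
begin

text \<open>
  Since \<open>norm u - 1 \<le> norm u ^ d\<close>, this dominates \<open>exp (- V / 8 * norm u ^ d)\<close>, where \<open>V\<close> is the
  volume of the unit ball, and being exponential in \<open>norm u\<close> it has a simple layer-cake formula.
\<close>

definition weight :: "'a \<Rightarrow> real" where
  "weight u = exp (unit_ball_vol DIM('a) / 8 - unit_ball_vol DIM('a) / 8 * norm u)"

lemma weight_eq: "weight u = exp (unit_ball_vol DIM('a) / 8) * exp (- (unit_ball_vol DIM('a) / 8) * norm u)"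
  unfolding weight_def by (subst exp_add[symmetric]) simp

lemma weight_pos: "0 < weight u"
  by (simp add: weight_def)

lemma borel_measurable_weight[measurable]: "weight \<in> borel_measurable borel"
  unfolding weight_def[abs_def] by measurable

lemma integrable_weight: "integrable lborel weight"
  unfolding weight_eq[abs_def] using V_pos by (intro integrable_mult_right integrable_exp_norm) simp

text \<open>The divisor 4 instead of 2 leaves room for pairs, where two points share the exponent.
  Together with the factor 1/2 lost in \<open>hit_lower_bound\<close> it accounts for V / 8 in
  \<open>weight\<close>.\<close>

lemma exp_scaled_hit_le_weight:
  assumes \<delta>: "\<And>y. dist y x \<le> \<delta> \<Longrightarrow> f x / 2 * unit_ball_vol DIM('a) * dist y x ^ DIM('a) \<le> hit y y"
    and n: "0 < n" and u: "dist (x + scale n *\<^sub>R u) x \<le> \<delta>"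
  shows "exp (- (real n * hit (x + scale n *\<^sub>R u) (x + scale n *\<^sub>R u)) / 4) \<le> weight u"
proof -
  let ?V = "unit_ball_vol (real DIM('a))"
  have "real n * (f x / 2 * ?V * dist (x + scale n *\<^sub>R u) x ^ DIM('a)) \<le> real n * hit (x + scale n *\<^sub>R u) (x + scale n *\<^sub>R u)"
    by (intro mult_left_mono \<delta>[OF u]) simp
  also have "real n * (f x / 2 * ?V * dist (x + scale n *\<^sub>R u) x ^ DIM('a)) = (real n * scale n ^ DIM('a) * f x) * (?V / 2 * norm u ^ DIM('a))"
    using scale_pos[of n] by (simp add: dist_norm power_mult_distrib)
  finally have *: "?V / 2 * norm u ^ DIM('a) \<le> real n * hit (x + scale n *\<^sub>R u) (x + scale n *\<^sub>R u)"
    unfolding scale_power[OF n] by simp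
  have "norm u - 1 \<le> norm u ^ DIM('a)"
  proof (cases "norm u \<le> 1")
    case False
    then have "norm u ^ 1 \<le> norm u ^ DIM('a)"
      using DIM_positive[where 'a='a] by (intro power_increasing) auto
    then show ?thesis by simp
  next
    case True
    then show ?thesis using zero_le_power[OF norm_ge_zero[of u], of "DIM('a)"] by linarith
  qed
  then have "?V / 8 * (norm u - 1) \<le> ?V / 8 * norm u ^ DIM('a)"
    using V_pos by (intro mult_left_mono) auto
  then have "?V / 8 * norm u - ?V / 8 \<le> ?V / 2 * norm u ^ DIM('a) / 4"
    by (simp add: right_diff_distrib)
  with * show ?thesis unfolding weight_def by simp
qed

lemma weighted_deviation_tendsto_0:
  "(\<lambda>n. \<integral>\<^sup>+u. ennreal (weight u * \<bar>f (x + scale n *\<^sub>R u) / f x - 1\<bar>) \<partial>lborel) \<longlonglongrightarrow> 0"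
proof -
  let ?c = "unit_ball_vol (real DIM('a)) / 8"
  obtain C where C: "0 \<le> C" "\<And>r. 0 < r \<Longrightarrow>
    (\<integral>\<^sup>+y\<in>ball x r. ennreal \<bar>f y - f x\<bar> \<partial>lborel) \<le> ennreal (C * r ^ DIM('a))"
    by (rule deviation_bound) blast
  have "(\<lambda>n. \<integral>\<^sup>+u. ennreal (exp (- ?c * norm u)) * ennreal \<bar>f (x + scale n *\<^sub>R u) - f x\<bar> \<partial>lborel) \<longlonglongrightarrow> 0"
  proof (rule tendsto_nn_integral_exp_weight[where g="\<lambda>y. ennreal \<bar>f y - f x\<bar>" and C=C])
    show "\<exists>d>0. \<forall>r. 0 < r \<longrightarrow> r < d \<longrightarrow> (\<integral>\<^sup>+y\<in>ball x r. ennreal \<bar>f y - f x\<bar> \<partial>lborel) \<le> ennreal (e * r ^ DIM('a))"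
      if "0 < e" for e
      using deviation_small[OF that] by metis
  qed (use C scale_pos scale_tendsto_0 V_pos in auto)
  then have "(\<lambda>n. ennreal (exp ?c / f x) * (\<integral>\<^sup>+u. ennreal (exp (- ?c * norm u)) * ennreal \<bar>f (x + scale n *\<^sub>R u) - f x\<bar> \<partial>lborel)) \<longlonglongrightarrow> ennreal (exp ?c / f x) * 0"
    by (intro tendsto_mult_ennreal tendsto_const) auto
  moreover have "ennreal (exp ?c / f x) * (\<integral>\<^sup>+u. ennreal (exp (- ?c * norm u)) * ennreal \<bar>f (x + scale n *\<^sub>R u) - f x\<bar> \<partial>lborel)
    = (\<integral>\<^sup>+u. ennreal (weight u * \<bar>f (x + scale n *\<^sub>R u) / f x - 1\<bar>) \<partial>lborel)" for n
  proof (subst nn_integral_cmult[symmetric])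
    show "(\<integral>\<^sup>+u. ennreal (exp ?c / f x) * (ennreal (exp (- ?c * norm u)) * ennreal \<bar>f (x + scale n *\<^sub>R u) - f x\<bar>) \<partial>lborel)
      = (\<integral>\<^sup>+u. ennreal (weight u * \<bar>f (x + scale n *\<^sub>R u) / f x - 1\<bar>) \<partial>lborel)"
    proof (intro nn_integral_cong)
      fix u
      have "f (x + scale n *\<^sub>R u) / f x - 1 = (f (x + scale n *\<^sub>R u) - f x) / f x"
        using f_pos by (simp add: diff_divide_distrib)
      then have "weight u * \<bar>f (x + scale n *\<^sub>R u) / f x - 1\<bar> = exp ?c / f x * (exp (- ?c * norm u) * \<bar>f (x + scale n *\<^sub>R u) - f x\<bar>)"
        using f_pos by (simp add: weight_eq)
      then show "ennreal (exp ?c / f x) * (ennreal (exp (- ?c * norm u)) * ennreal \<bar>f (x + scale n *\<^sub>R u) - f x\<bar>)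
        = ennreal (weight u * \<bar>f (x + scale n *\<^sub>R u) / f x - 1\<bar>)"
        using f_pos by (simp add: ennreal_mult'[symmetric])
    qed
  qed measurable
  ultimately show ?thesis by (simp only: mult_zero_right)
qed

lemma first_moment_tendsto:
  "(\<lambda>n. real n * (\<integral>y. f y * (1 - hit y y) ^ (n - 1) \<partial>lborel)) \<longlonglongrightarrow> 1"
proof -
  obtain \<delta> where \<delta>: "0 < \<delta>" "\<And>y. dist y x \<le> \<delta> \<Longrightarrow> f x / 2 * unit_ball_vol DIM('a) * dist y x ^ DIM('a) \<le> hit y y"
    "\<And>y. \<delta> < dist y x \<Longrightarrow> f x / 2 * unit_ball_vol DIM('a) * \<delta> ^ DIM('a) \<le> hit y y"
    by (rule hit_lower_bound) blast
  have "(\<lambda>n. real n ^ 1 * (\<integral>y. f y * (1 - hit y y) ^ (n - 1) \<partial>lborel)) \<longlonglongrightarrow> (\<integral>u. exp (- two_balls_volume u u) \<partial>(lborel :: 'a measure))"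
  \<comment> \<open>\<open>min 1\<close> secures c \<le> 1, required for the geometric decay away
    from x.\<close>
  proof (rule tendsto_scaled_integral_one_minus_power[where x=x and h=scale and A="f x" and G=weight and N="cball x \<delta>"
        and c="min 1 (f x / 2 * unit_ball_vol DIM('a) * \<delta> ^ DIM('a))"])
    show "eventually (\<lambda>n. x + scale n *\<^sub>R u \<in> cball x \<delta>) sequentially" for u
    proof -
      have "(\<lambda>n. scale n * norm u) \<longlonglongrightarrow> 0 * norm u" by (intro tendsto_intros scale_tendsto_0)
      then have "eventually (\<lambda>n. scale n * norm u < \<delta>) sequentially"
        using \<delta>(1) by (intro order_tendstoD(2)) auto
      then show ?thesis
        by eventually_elim (use less_imp_le[OF scale_pos] in \<open>auto simp: dist_norm\<close>)
    qed
    show "exp (- (real n * hit (x + scale n *\<^sub>R u) (x + scale n *\<^sub>R u)) / 2) \<le> weight u"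
      if "0 < n" "x + scale n *\<^sub>R u \<in> cball x \<delta>" for n u
    proof -
      let ?t = "real n * hit (x + scale n *\<^sub>R u) (x + scale n *\<^sub>R u)"
      have "0 \<le> ?t" using hit_bounds by simp
      \<comment> \<open>One point alone would allow the divisor 2; weakening it to 4 lets one weight
        serve both moments.\<close>
      then have "exp (- ?t / 2) \<le> exp (- ?t / 4)" by (subst exp_le_cancel_iff) linarith
      also have "\<dots> \<le> weight u"
        using that by (intro exp_scaled_hit_le_weight[OF \<delta>(2)]) (auto simp: dist_commute)
      finally show ?thesis .
    qed
    show "min 1 (f x / 2 * unit_ball_vol DIM('a) * \<delta> ^ DIM('a)) \<le> hit w w" if "w \<notin> cball x \<delta>" for w
      using that \<delta>(3)[of w] by (auto simp: dist_commute intro: min.coboundedI2)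
  qed (use f_nonneg integrable_f integral_f hit_bounds scale_pos scale_power f_pos integrable_weight weight_pos
      weighted_deviation_tendsto_0 scaled_hit_tendsto \<delta>(1) V_pos in auto)
  moreover have "(\<integral>u. exp (- two_balls_volume u u) \<partial>(lborel :: 'a measure)) = 1"
    using nn_integral_exp_ball_volume[where 'a='a]
    by (subst integral_eq_nn_integral) (auto simp: two_balls_volume_same)
  ultimately show ?thesis by simp
qed


lemma nn_integral_weight_finite: "(\<integral>\<^sup>+u. ennreal (weight u) \<partial>lborel) < \<infinity>"
  using integrable_weight weight_pos
  by (subst nn_integral_eq_integral) (auto intro: less_imp_le)

text \<open>With s and t the two density ratios, s t - 1 = (s - 1)(t - 1) + (s - 1) + (t - 1). As
  the weight is a product, each term integrates to a product of one-point integrals, at least one of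
  which tends to 0 while the other stays finite.\<close>

lemma weighted_deviation_pair_tendsto_0:
  "(\<lambda>n. \<integral>\<^sup>+p. ennreal (weight (fst p) * weight (snd p) *
      \<bar>f (x + scale n *\<^sub>R fst p) * f (x + scale n *\<^sub>R snd p) / (f x)\<^sup>2 - 1\<bar>) \<partial>lborel) \<longlonglongrightarrow> 0"
proof -
  define W where "W n u = weight u * \<bar>f (x + scale n *\<^sub>R u) / f x - 1\<bar>" for n u
  have [measurable]: "W n \<in> borel_measurable borel" for n
    unfolding W_def[abs_def] by measurable
  have W0: "0 \<le> W n u" for n u by (simp add: W_def weight_pos less_imp_le)
  define I where "I n = (\<integral>\<^sup>+u. ennreal (W n u) \<partial>lborel)" for n
  define w where "w = (\<integral>\<^sup>+u. ennreal (weight u) \<partial>lborel)"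
  have I: "I \<longlonglongrightarrow> 0" unfolding I_def W_def by (rule weighted_deviation_tendsto_0)
  have w: "w \<noteq> \<infinity>" using nn_integral_weight_finite by (simp add: w_def)
  have lim: "(\<lambda>n. I n * I n + I n * w + w * I n) \<longlonglongrightarrow> 0 * 0 + 0 * w + w * 0"
    using w by (intro tendsto_add tendsto_mult_ennreal I tendsto_const) auto
  show ?thesis
  proof (rule tendsto_sandwich[OF _ _ tendsto_const])
    show "(\<lambda>n. I n * I n + I n * w + w * I n) \<longlonglongrightarrow> 0" using lim by simp
    show "eventually (\<lambda>n. (\<integral>\<^sup>+p. ennreal (weight (fst p) * weight (snd p) *
      \<bar>f (x + scale n *\<^sub>R fst p) * f (x + scale n *\<^sub>R snd p) / (f x)\<^sup>2 - 1\<bar>) \<partial>lborel) \<le> I n * I n + I n * w + w * I n) sequentially"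
    proof (intro always_eventually allI)
      fix n
      have "(\<integral>\<^sup>+p. ennreal (weight (fst p) * weight (snd p) *
        \<bar>f (x + scale n *\<^sub>R fst p) * f (x + scale n *\<^sub>R snd p) / (f x)\<^sup>2 - 1\<bar>) \<partial>lborel) \<le>
        (\<integral>\<^sup>+p. ennreal (W n (fst p)) * ennreal (W n (snd p)) + ennreal (W n (fst p)) * ennreal (weight (snd p))
          + ennreal (weight (fst p)) * ennreal (W n (snd p)) \<partial>lborel)"
      proof (intro nn_integral_mono)
        fix p :: "'a \<times> 'a"
        define s where "s = f (x + scale n *\<^sub>R fst p) / f x"
        define t where "t = f (x + scale n *\<^sub>R snd p) / f x"
        have st: "f (x + scale n *\<^sub>R fst p) * f (x + scale n *\<^sub>R snd p) / (f x)\<^sup>2 = s * t"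
          by (simp add: s_def t_def power2_eq_square)
        have eq: "s * t - 1 = (s - 1) * (t - 1) + (s - 1) + (t - 1)" by (simp add: algebra_simps)
        have "\<bar>s * t - 1\<bar> \<le> \<bar>s - 1\<bar> * \<bar>t - 1\<bar> + \<bar>s - 1\<bar> + \<bar>t - 1\<bar>"
          unfolding eq abs_mult[symmetric] by linarith
        then have "weight (fst p) * weight (snd p) * \<bar>s * t - 1\<bar> \<le>
          weight (fst p) * weight (snd p) * (\<bar>s - 1\<bar> * \<bar>t - 1\<bar> + \<bar>s - 1\<bar> + \<bar>t - 1\<bar>)"
          using weight_pos by (intro mult_left_mono) (auto intro: less_imp_le)
        also have "\<dots> = W n (fst p) * W n (snd p) + W n (fst p) * weight (snd p) + weight (fst p) * W n (snd p)"
          by (simp add: W_def s_def t_def algebra_simps)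
        finally have "ennreal (weight (fst p) * weight (snd p) * \<bar>s * t - 1\<bar>) \<le>
           ennreal (W n (fst p) * W n (snd p) + W n (fst p) * weight (snd p) + weight (fst p) * W n (snd p))"
          by (rule ennreal_leI)
        then show "ennreal (weight (fst p) * weight (snd p) *
          \<bar>f (x + scale n *\<^sub>R fst p) * f (x + scale n *\<^sub>R snd p) / (f x)\<^sup>2 - 1\<bar>) \<le>
          ennreal (W n (fst p)) * ennreal (W n (snd p)) + ennreal (W n (fst p)) * ennreal (weight (snd p))
          + ennreal (weight (fst p)) * ennreal (W n (snd p))"
          unfolding st using W0 less_imp_le[OF weight_pos] by (simp add: ennreal_mult)
      qed
      also have "\<dots> = I n * I n + I n * w + w * I n"
      proof -
        have "(\<integral>\<^sup>+p. ennreal (W n (fst p)) * ennreal (W n (snd p)) + ennreal (W n (fst p)) * ennreal (weight (snd p))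
          + ennreal (weight (fst p)) * ennreal (W n (snd p)) \<partial>(lborel :: ('a \<times> 'a) measure)) =
          (\<integral>\<^sup>+p. ennreal (W n (fst p)) * ennreal (W n (snd p)) + ennreal (W n (fst p)) * ennreal (weight (snd p)) \<partial>(lborel :: ('a \<times> 'a) measure))
          + (\<integral>\<^sup>+p. ennreal (weight (fst p)) * ennreal (W n (snd p)) \<partial>(lborel :: ('a \<times> 'a) measure))"
          by (rule nn_integral_add) measurable
        also have "(\<integral>\<^sup>+p. ennreal (W n (fst p)) * ennreal (W n (snd p)) + ennreal (W n (fst p)) * ennreal (weight (snd p)) \<partial>(lborel :: ('a \<times> 'a) measure))
          = (\<integral>\<^sup>+p. ennreal (W n (fst p)) * ennreal (W n (snd p)) \<partial>(lborel :: ('a \<times> 'a) measure))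
          + (\<integral>\<^sup>+p. ennreal (W n (fst p)) * ennreal (weight (snd p)) \<partial>(lborel :: ('a \<times> 'a) measure))"
          by (rule nn_integral_add) measurable
        finally show ?thesis
          unfolding I_def w_def
          using nn_integral_lborel_fst_snd[of "\<lambda>u. ennreal (W n u)" "\<lambda>u. ennreal (W n u)"]
            nn_integral_lborel_fst_snd[of "\<lambda>u. ennreal (W n u)" "\<lambda>u. ennreal (weight u)"]
            nn_integral_lborel_fst_snd[of "\<lambda>u. ennreal (weight u)" "\<lambda>u. ennreal (W n u)"]
          by simp
      qed
      finally show "(\<integral>\<^sup>+p. ennreal (weight (fst p) * weight (snd p) *
        \<bar>f (x + scale n *\<^sub>R fst p) * f (x + scale n *\<^sub>R snd p) / (f x)\<^sup>2 - 1\<bar>) \<partial>lborel) \<le> I n * I n + I n * w + w * I n" .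
    qed
  qed auto
qed

lemma second_moment_tendsto:
  "(\<lambda>n. (real n)\<^sup>2 * (\<integral>p. f (fst p) * f (snd p) * (1 - hit (fst p) (snd p)) ^ (n - 1) \<partial>lborel))
    \<longlonglongrightarrow> (\<integral>p. exp (- two_balls_volume (fst p) (snd p)) \<partial>(lborel :: ('a \<times> 'a) measure))"
proof -
  obtain \<delta> where \<delta>: "0 < \<delta>" "\<And>y. dist y x \<le> \<delta> \<Longrightarrow> f x / 2 * unit_ball_vol DIM('a) * dist y x ^ DIM('a) \<le> hit y y"
    "\<And>y. \<delta> < dist y x \<Longrightarrow> f x / 2 * unit_ball_vol DIM('a) * \<delta> ^ DIM('a) \<le> hit y y"
    by (rule hit_lower_bound) blast
  have ff: "(\<integral>\<^sup>+p. ennreal (f (fst p) * f (snd p)) \<partial>(lborel :: ('a \<times> 'a) measure)) = 1"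
    using nn_integral_lborel_fst_snd[of "\<lambda>u. ennreal (f u)" "\<lambda>u. ennreal (f u)"] f_nonneg
    by (simp add: nn_integral_f ennreal_mult)
  have ww: "(\<integral>\<^sup>+p. ennreal (weight (fst p) * weight (snd p)) \<partial>(lborel :: ('a \<times> 'a) measure)) < \<infinity>"
    using nn_integral_lborel_fst_snd[of "\<lambda>u. ennreal (weight u)" "\<lambda>u. ennreal (weight u)"]
      nn_integral_weight_finite less_imp_le[OF weight_pos]
    by (simp add: ennreal_mult ennreal_mult_less_top)
  show ?thesis
  proof (rule tendsto_scaled_integral_one_minus_power[where x="(x, x)" and h=scale and A="(f x)\<^sup>2" and k=2
        and G="\<lambda>p. weight (fst p) * weight (snd p)" and N="cball x \<delta> \<times> cball x \<delta>" and q="\<lambda>p. hit (fst p) (snd p)"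
        and c="min 1 (f x / 2 * unit_ball_vol DIM('a) * \<delta> ^ DIM('a))"])
    show "integrable lborel (\<lambda>p :: 'a \<times> 'a. f (fst p) * f (snd p))"
      using ff f_nonneg by (intro integrableI_nonneg) auto
    show "(\<integral>p. f (fst p) * f (snd p) \<partial>(lborel :: ('a \<times> 'a) measure)) \<le> 1"
      using ff f_nonneg by (subst integral_eq_nn_integral) auto
    show "integrable lborel (\<lambda>p :: 'a \<times> 'a. weight (fst p) * weight (snd p))"
      using ww less_imp_le[OF weight_pos] by (intro integrableI_nonneg) auto
    show "real n ^ 2 * scale n ^ DIM('a \<times> 'a) * (f x)\<^sup>2 = 1" if "0 < n" for n
    proof -
      have "real n ^ 2 * scale n ^ DIM('a \<times> 'a) * (f x)\<^sup>2 = (real n * scale n ^ DIM('a) * f x)\<^sup>2"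
        by (simp add: power_mult_distrib power_add power2_eq_square)
      then show ?thesis using scale_power[OF that] by simp
    qed
    show "(\<lambda>n. \<integral>\<^sup>+p. ennreal (weight (fst p) * weight (snd p) *
      \<bar>f (fst ((x, x) + scale n *\<^sub>R p)) * f (snd ((x, x) + scale n *\<^sub>R p)) / (f x)\<^sup>2 - 1\<bar>) \<partial>lborel) \<longlonglongrightarrow> 0"
      using weighted_deviation_pair_tendsto_0 by simp
    show "(\<lambda>n. real n * hit (fst ((x, x) + scale n *\<^sub>R p)) (snd ((x, x) + scale n *\<^sub>R p))) \<longlonglongrightarrow> two_balls_volume (fst p) (snd p)" for p
      using scaled_hit_tendsto[of "fst p" "snd p"] by simp
    show "cball x \<delta> \<times> cball x \<delta> \<in> sets borel"
      by (intro borel_closed closed_Times) auto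
    show "eventually (\<lambda>n. (x, x) + scale n *\<^sub>R p \<in> cball x \<delta> \<times> cball x \<delta>) sequentially" for p
    proof -
      have "(\<lambda>n. scale n * (norm (fst p) + norm (snd p))) \<longlonglongrightarrow> 0 * (norm (fst p) + norm (snd p))"
        by (intro tendsto_intros scale_tendsto_0)
      then have "eventually (\<lambda>n. scale n * (norm (fst p) + norm (snd p)) < \<delta>) sequentially"
        using \<delta>(1) by (intro order_tendstoD(2)) auto
      then show ?thesis
      proof eventually_elim
        case (elim n)
        have "0 \<le> scale n * norm (fst p)" "0 \<le> scale n * norm (snd p)"
          using less_imp_le[OF scale_pos[of n]] by auto
        then have "scale n * norm (fst p) \<le> \<delta>" "scale n * norm (snd p) \<le> \<delta>"
          using elim unfolding distrib_left by linarith+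
        then show ?case
          using less_imp_le[OF scale_pos[of n]] by (auto simp: mem_Times_iff dist_norm)
      qed
    qed
    show "exp (- (real n * hit (fst ((x, x) + scale n *\<^sub>R p)) (snd ((x, x) + scale n *\<^sub>R p))) / 2) \<le> weight (fst p) * weight (snd p)"
      if "0 < n" "(x, x) + scale n *\<^sub>R p \<in> cball x \<delta> \<times> cball x \<delta>" for n p
    proof -
      let ?y = "x + scale n *\<^sub>R fst p" and ?z = "x + scale n *\<^sub>R snd p"
      \<comment> \<open>The joint value dominates the average of the two single ones, which splits
        the exponent into two quarters, one for each weight.\<close>
      have "hit ?y ?y + hit ?z ?z \<le> 2 * hit ?y ?z" using hit_ge[of ?y ?z] hit_ge[of ?z ?y]
        by (auto simp: hit_def Un_commute)
      then have "real n * (hit ?y ?y + hit ?z ?z) \<le> real n * (2 * hit ?y ?z)" by (intro mult_left_mono) auto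
      then have "exp (- (real n * hit ?y ?z) / 2) \<le> exp (- (real n * hit ?y ?y) / 4 + - (real n * hit ?z ?z) / 4)"
        by (subst exp_le_cancel_iff) (simp add: distrib_left)
      also have "\<dots> = exp (- (real n * hit ?y ?y) / 4) * exp (- (real n * hit ?z ?z) / 4)"
        by (rule exp_add)
      also have "\<dots> \<le> weight (fst p) * weight (snd p)"
        using that less_imp_le[OF weight_pos]
        by (intro mult_mono exp_scaled_hit_le_weight[OF \<delta>(2)]) (auto simp: dist_commute mem_Times_iff)
      finally show ?thesis by simp
    qed
    show "min 1 (f x / 2 * unit_ball_vol DIM('a) * \<delta> ^ DIM('a)) \<le> hit (fst w) (snd w)" if "w \<notin> cball x \<delta> \<times> cball x \<delta>" for w
    proof -
      \<comment> \<open>One far coordinate is enough: its own ball already carries the required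
        mass.\<close>
      have "\<delta> < dist (fst w) x \<or> \<delta> < dist (snd w) x"
        using that by (auto simp: mem_Times_iff dist_commute not_le)
      then have "f x / 2 * unit_ball_vol DIM('a) * \<delta> ^ DIM('a) \<le> hit (fst w) (snd w)"
        using \<delta>(3) hit_ge order_trans by metis
      then show ?thesis by (rule min.coboundedI2)
    qed
  qed (use f_nonneg hit_bounds scale_pos f_pos weight_pos \<delta>(1) V_pos in auto)
qed

end

section \<open>Almost sure limits\<close>

text \<open>Under the density f, an almost-everywhere statement for \<mu> is a Lebesgue one
  restricted to f > 0, so positivity at x comes for free.\<close>

lemma (in sample_with_density) AE_lebesgue_point_density:
  "AE x in \<mu>. lebesgue_point_density \<mu> f x"
proof -
  have "(\<integral>\<^sup>+y. ennreal (f y) \<partial>lborel) = 1"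
    using mu.emeasure_space_1 by (simp add: mu_density emeasure_density)
  then have "integrable lborel f"
    using f_nonneg by (intro integrableI_nonneg) auto
  from AE_lebesgue_point[OF this]
  have "AE x in lborel. 0 < f x \<longrightarrow> lebesgue_point_density \<mu> f x"
  proof eventually_elim
    case (elim x)
    then show ?case
      using f_nonneg mu_density mu.prob_space_axioms
      by (auto intro!: lebesgue_point_density.intro lebesgue_point_density_axioms.intro)
  qed
  then show ?thesis
    by (subst mu_density, subst AE_density) simp_all
qed

theorem theorem1:
  fixes \<mu> :: "(real ^ 'd) measure"
    and f :: "real ^ 'd \<Rightarrow> real"
    and M :: "'w measure"
    and X :: "nat \<Rightarrow> 'w \<Rightarrow> real ^ 'd"
  assumes "prob_space \<mu>"
    and "f \<in> borel_measurable lborel"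
    and "\<And>x. 0 \<le> f x"
    and "\<mu> = density lborel (\<lambda>x. ennreal (f x))"
    and "prob_space M"
    and "prob_space.indep_vars M (\<lambda>_. borel) X {1..}"
    and "\<And>i. i \<ge> 1 \<Longrightarrow> distr M borel (X i) = \<mu>"
  shows "(AE x in \<mu>.
            (\<lambda>n. real n *
               (\<integral>\<omega>. measure \<mu> (voronoi_cell ((\<lambda>j. X j \<omega>)(1 := x)) n 1) \<partial>M))
              \<longlonglongrightarrow> 1) \<and>
         (AE x in \<mu>.
            (\<lambda>n. (real n)\<^sup>2 *
               (\<integral>\<omega>. (measure \<mu> (voronoi_cell ((\<lambda>j. X j \<omega>)(1 := x)) n 1))\<^sup>2 \<partial>M))
              \<longlonglongrightarrow> alpha TYPE('d))"
proof -
  interpret sample_with_density M \<mu> f X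
    using assms by (auto intro!: sample_with_density.intro sample_with_density_axioms.intro)
  show ?thesis
  proof
    show "AE x in \<mu>. (\<lambda>n. real n *
        (\<integral>\<omega>. measure \<mu> (voronoi_cell ((\<lambda>j. X j \<omega>)(1 := x)) n 1) \<partial>M)) \<longlonglongrightarrow> 1"
      using AE_lebesgue_point_density
    proof eventually_elim
      case (elim x)
      then interpret lebesgue_point_density \<mu> f x .
      \<comment> \<open>\<open>hit y y\<close> is the measure of a ball united with itself, hence
        \<open>Un_absorb\<close>.\<close>
      show ?case
        using first_moment_tendsto unfolding expectation_measure_voronoi_cell hit_def Un_absorb .
    qed
    show "AE x in \<mu>. (\<lambda>n. (real n)\<^sup>2 *
        (\<integral>\<omega>. (measure \<mu> (voronoi_cell ((\<lambda>j. X j \<omega>)(1 := x)) n 1))\<^sup>2 \<partial>M)) \<longlonglongrightarrow> alpha TYPE('d)"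
      using AE_lebesgue_point_density
    proof eventually_elim
      case (elim x)
      then interpret lebesgue_point_density \<mu> f x .
      show ?case
        using second_moment_tendsto
        unfolding expectation_measure_voronoi_cell_square hit_def integral_exp_two_balls .
    qed
  qed
qed

end
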